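(* Let $p\geq 1$ be a real number, let $k\geq 6$ be an integer, and let $H$ be a $3$-uniform hypergraph that is a Berge-$C_k$, where $C_k$ is the cycle on $k$ vertices. Then $\lambda^{(p)}(H)\leq\lambda^{(p)}(\Delta_2\ast K_1)$. Furthermore, if $p>2$, then equality holds if and only if $H\cong\Delta_2\ast K_1$.
   Context: All graphs and hypergraphs are finite and simple (no repeated edges); hypergraphs that are Berge-$G$ are taken to have no isolated vertices. An $r$-uniform hypergraph ($r$-graph) has all edges of size $r$. Berge-$G$: for a graph $G$, a hypergraph $H$ is a Berge-$G$ if (after identifying $V(G)$ with a subset of $V(H)$ by an injection) there is a bijection $\phi:E(G)\to E(H)$ with $e\subseteq\phi(e)$ for all $e\in E(G)$. $p$-spectral radius: for an $r$-uniform hypergraph $H$ on vertex set $\{1,\dots,n\}$ and real $p\geq 1$, $\lambda^{(p)}(H):=\max_{\|x\|_p=1} r\sum_{\{i_1,\ldots,i_r\}\in E(H)}x_{i_1}\cdots x_{i_r}$, the maximum over $x\in\mathbb{R}^n$ with $\|x\|_p=(\sum_i|x_i|^p)^{1/p}=1$. Suspension: for a graph $F$, $F\ast K_1$ is the $3$-uniform hypergraph with vertex set $V(F)\cup\{w\}$, $w\notin V(F)$ a new vertex, and edge set $\{e\cup\{w\}:e\in E(F)\}$. $\Delta_2$ is the graph on $k-1$ vertices obtained from a triangle $C_3$ and a disjoint cycle $C_{k-3}$ by identifying one vertex of $C_3$ with one vertex of $C_{k-3}$. *)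

theory Defs
  imports "HOL-Analysis.Analysis"
begin

text \<open>A hypergraph is a pair of a vertex set and a set of edges; a graph is a 2-uniform hypergraph.\<close>

type_synonym 'a hypergraph = "'a set \<times> 'a set set"

abbreviation verts :: "'a hypergraph \<Rightarrow> 'a set" where "verts H \<equiv> fst H"
abbreviation edges :: "'a hypergraph \<Rightarrow> 'a set set" where "edges H \<equiv> snd H"

definition uniform_hypergraph :: "nat \<Rightarrow> 'a hypergraph \<Rightarrow> bool" where
  "uniform_hypergraph r H \<longleftrightarrow>
     finite (verts H) \<and> (\<forall>e \<in> edges H. e \<subseteq> verts H \<and> card e = r)"

definition no_isolated_vertices :: "'a hypergraph \<Rightarrow> bool" where
  "no_isolated_vertices H \<longleftrightarrow> (\<forall>v \<in> verts H. \<exists>e \<in> edges H. v \<in> e)"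

definition hypergraph_iso :: "'a hypergraph \<Rightarrow> 'b hypergraph \<Rightarrow> bool" (infix "\<simeq>\<^sub>H" 50) where
  "H \<simeq>\<^sub>H H' \<longleftrightarrow>
     (\<exists>f. bij_betw f (verts H) (verts H') \<and> edges H' = (\<lambda>e. f ` e) ` edges H)"

definition is_Berge :: "'b hypergraph \<Rightarrow> 'a hypergraph \<Rightarrow> bool" where
  "is_Berge G H \<longleftrightarrow>
     (\<exists>f \<phi>. inj_on f (verts G) \<and> f ` verts G \<subseteq> verts H \<and>
            bij_betw \<phi> (edges G) (edges H) \<and> (\<forall>e \<in> edges G. f ` e \<subseteq> \<phi> e))"

definition p_norm_on :: "'a set \<Rightarrow> real \<Rightarrow> ('a \<Rightarrow> real) \<Rightarrow> real" where
  "p_norm_on V p x = (\<Sum>i\<in>V. \<bar>x i\<bar> powr p) powr (1 / p)"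

text \<open>Vectors indexed by the vertex set are total functions whose values outside the
  vertex set are irrelevant; \<open>GREATEST\<close> denotes the maximum, which exists by
  \<open>p_spectral_radius_attained\<close> below.\<close>

definition p_spectral_radius :: "nat \<Rightarrow> real \<Rightarrow> 'a hypergraph \<Rightarrow> real" where
  "p_spectral_radius r p H =
     (GREATEST t. \<exists>x. p_norm_on (verts H) p x = 1 \<and> t = real r * (\<Sum>e\<in>edges H. \<Prod>i\<in>e. x i))"

lemma p_spectral_radius_attained:
  assumes H: "uniform_hypergraph r H" and ne: "verts H \<noteq> {}" and p: "p \<ge> 1"
  shows "\<exists>x. p_norm_on (verts H) p x = 1 \<and>
             p_spectral_radius r p H = real r * (\<Sum>e\<in>edges H. \<Prod>i\<in>e. x i)"
    and "p_norm_on (verts H) p y = 1 \<Longrightarrow>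
           real r * (\<Sum>e\<in>edges H. \<Prod>i\<in>e. y i) \<le> p_spectral_radius r p H"
proof -
  let ?V = "verts H"
  let ?P = "\<lambda>x. real r * (\<Sum>e\<in>edges H. \<Prod>i\<in>e. x i)"
  have fin: "finite ?V" and sub: "\<And>e. e \<in> edges H \<Longrightarrow> e \<subseteq> ?V"
    using H by (auto simp: uniform_hypergraph_def)
  have cont_norm: "continuous_on UNIV (p_norm_on ?V p)"
    unfolding p_norm_on_def
    by (intro continuous_on_powr' continuous_intros continuous_on_product_coordinates sum_nonneg)
       (use p in \<open>auto intro!: sum_nonneg\<close>)
  have cont_P: "continuous_on UNIV ?P"
    by (intro continuous_intros continuous_on_product_coordinates)
  define K where "K = (\<Pi>\<^sub>E i\<in>UNIV. if i \<in> ?V then {-1..1::real} else {0})"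
  define S where "S = K \<inter> {x. p_norm_on ?V p x = 1}"
  have "compact K"
  proof -
    have "compactin (product_topology (\<lambda>_::'a. euclidean) UNIV) K"
      unfolding K_def by (subst compactin_PiE) auto
    then show ?thesis
      by (simp only: euclidean_product_topology compactin_euclidean_iff)
  qed
  moreover have "closed {x. p_norm_on ?V p x = 1}"
    using cont_norm by (intro closed_Collect_eq) auto
  ultimately have "compact S"
    unfolding S_def by (rule compact_Int_closed)
  obtain v where v: "v \<in> ?V" using ne by blast
  have "(\<lambda>i. if i = v then 1 else 0) \<in> S"
  proof -
    have "(\<Sum>i\<in>?V. \<bar>if i = v then 1 else 0::real\<bar> powr p) = (\<Sum>i\<in>?V. if i = v then 1 else 0)"
      by (rule sum.cong) auto
    then show ?thesis
      using v fin by (auto simp: S_def K_def p_norm_on_def)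
  qed
  then have "S \<noteq> {}" by blast
  with \<open>compact S\<close> obtain x where x: "x \<in> S" "\<And>y. y \<in> S \<Longrightarrow> ?P y \<le> ?P x"
    using continuous_attains_sup[of S ?P] continuous_on_subset[OF cont_P] by auto
  have max: "?P y \<le> ?P x" if y: "p_norm_on ?V p y = 1" for y
  proof -
    let ?y = "\<lambda>i. if i \<in> ?V then y i else 0"
    have "\<bar>y i\<bar> \<le> 1" if i: "i \<in> ?V" for i
    proof (rule ccontr)
      assume "\<not> \<bar>y i\<bar> \<le> 1"
      then have "1 < \<bar>y i\<bar> powr p" using p by (intro gr_one_powr) auto
      also have "\<dots> \<le> (\<Sum>i\<in>?V. \<bar>y i\<bar> powr p)"
        using i fin by (intro member_le_sum) auto
      finally have "1 < (\<Sum>i\<in>?V. \<bar>y i\<bar> powr p) powr (1 / p)"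
        using p by (intro gr_one_powr) auto
      with y show False by (simp add: p_norm_on_def)
    qed
    then have "-1 \<le> y i \<and> y i \<le> 1" if "i \<in> ?V" for i
      using that by (simp add: abs_le_iff)
    then have "?y \<in> K" by (auto simp: K_def)
    moreover have "p_norm_on ?V p ?y = 1"
      using y by (simp add: p_norm_on_def cong: sum.cong)
    ultimately have "?y \<in> S"
      by (simp add: S_def)
    moreover have "?P ?y = ?P y"
      using sub by (intro arg_cong[where f = "\<lambda>t. real r * t"] sum.cong prod.cong) auto
    ultimately show ?thesis using x(2)[of ?y] by metis
  qed
  have x1: "p_norm_on ?V p x = 1" using x(1) by (simp add: S_def)
  have "p_spectral_radius r p H = ?P x"
    unfolding p_spectral_radius_def by (rule Greatest_equality) (use x1 max in auto)
  then show "\<exists>x. p_norm_on ?V p x = 1 \<and> p_spectral_radius r p H = ?P x"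
    and "p_norm_on ?V p y = 1 \<Longrightarrow> ?P y \<le> p_spectral_radius r p H"
    using x1 max by auto
qed

text \<open>The cycle running through a list of pairwise distinct vertices of length at least 3.\<close>

definition cycle_through :: "'a list \<Rightarrow> 'a hypergraph" where
  "cycle_through vs =
     (set vs, {{vs ! i, vs ! (Suc i mod length vs)} | i. i < length vs})"

definition cycle_graph :: "nat \<Rightarrow> nat hypergraph" where
  "cycle_graph k = cycle_through [0..<k]"

text \<open>The triangle 0, 1, 2 and the cycle 0, 3, 4, ..., k - 2 of length k - 3 share exactly
  the vertex 0; meant for k at least 6.\<close>

definition Delta2 :: "nat \<Rightarrow> nat hypergraph" where
  "Delta2 k =
     (let T = cycle_through [0, 1, 2]; C = cycle_through (0 # [3..<k - 1])
      in (verts T \<union> verts C, edges T \<union> edges C))"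

text \<open>\<open>None\<close> is the new vertex.\<close>

definition suspension :: "'a hypergraph \<Rightarrow> 'a option hypergraph" where
  "suspension F =
     (insert None (Some ` verts F), (\<lambda>e. insert None (Some ` e)) ` edges F)"

end

theory Submission
  imports Defs
begin

text \<open>
  Let \<open>x\<close> be a nonnegative maximiser for \<open>H\<close> and let \<open>w\<close> be a vertex of largest weight. The
  argument compares \<open>H\<close>, for this fixed \<open>x\<close>, with a copy of the suspended \<open>\<Delta>\<^sub>2\<close> placed on the \<open>k\<close>
  heaviest vertices in order of weight.

  Every edge of a Berge cycle contains two consecutive cycle vertices. Replacing its third vertex by
  \<open>w\<close>, or, when \<open>w\<close> itself lies on the cycle, exchanging a few edges next to \<open>w\<close>, bounds the edge sum
  of \<open>H\<close> by \<open>x w\<close> times the edge sum of a simple graph: a path on \<open>k - 1\<close> vertices together with one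
  additional edge at each end of the path (\<open>Berge_edge_sum_le\<close>). By Abel summation, the sum of the
  products of weights over the edges of such a graph is a nonnegative combination of the numbers of
  arcs from the \<open>s\<close> heaviest to the \<open>t\<close> heaviest vertices. Three facts limit these numbers:
  the graph is simple, a set of at most \<open>k - 2\<close> vertices spans at most as many edges as it has
  vertices, and the degrees exceed 2 by at most 2 in total. The graph \<open>\<Delta>\<^sub>2\<close> in sorted position meets
  the resulting bound for all \<open>s\<close> and \<open>t\<close> at once (\<open>arcs_le_core_count\<close>), so it has the largest edge
  sum for every choice of weights. Since the radius is the maximum of a homogeneous form, the
  inequality follows (\<open>edge_sum_le_core_edge_sum\<close>).

  If \<open>p > 2\<close>, the maximiser is positive everywhere, because \<open>H\<close> is connected and raising all zero
  weights of one edge to \<open>\<epsilon>\<close> gains at least order \<open>\<epsilon>\<^sup>2\<close> and costs only order \<open>\<epsilon>\<^sup>p\<close>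
  (\<open>maximiser_positive\<close>). In the case of equality \<open>H\<close> therefore has exactly \<open>k\<close> vertices and \<open>x\<close> is a
  maximiser for \<open>H\<close> and for the copy of the suspended \<open>\<Delta>\<^sub>2\<close> alike. The eigenequations of both
  hypergraphs hold, so their link sums agree at every vertex. This forces \<open>w\<close> into all edges of \<open>H\<close>,
  forces the second heaviest vertex \<open>c\<close> to have degree 4 in the link of \<open>w\<close>, and makes a heaviest
  neighbour of \<open>c\<close> lie on a triangle through \<open>c\<close> (\<open>extremal_Berge_cycle_iso\<close>).
\<close>

section \<open>Maximisers of the edge sum\<close>

definition edge_sum :: "'a hypergraph \<Rightarrow> ('a \<Rightarrow> real) \<Rightarrow> real" where
  "edge_sum H x = (\<Sum>e\<in>edges H. \<Prod>i\<in>e. x i)"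

definition link_sum :: "'a hypergraph \<Rightarrow> ('a \<Rightarrow> real) \<Rightarrow> 'a \<Rightarrow> real" where
  "link_sum H x v = (\<Sum>e\<in>{e\<in>edges H. v \<in> e}. \<Prod>i\<in>e - {v}. x i)"

lemma uniform_finite:
  assumes "uniform_hypergraph r H"
  shows "finite (verts H)" "finite (edges H)" "e \<in> edges H \<Longrightarrow> finite e"
    "e \<in> edges H \<Longrightarrow> e \<subseteq> verts H" "e \<in> edges H \<Longrightarrow> card e = r"
proof -
  show f: "finite (verts H)" and sub: "\<And>e. e \<in> edges H \<Longrightarrow> e \<subseteq> verts H"
    and "e \<in> edges H \<Longrightarrow> card e = r"
    using assms by (auto simp: uniform_hypergraph_def)
  show "e \<in> edges H \<Longrightarrow> finite e" using f sub by (metis finite_subset)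
  have "edges H \<subseteq> Pow (verts H)" using sub by blast
  then show "finite (edges H)" using f by (meson finite_Pow_iff finite_subset)
qed

lemma spectral_radius_iso_invariant:
  assumes H: "uniform_hypergraph s H" and iso: "H \<simeq>\<^sub>H H'"
  shows "p_spectral_radius r p H = p_spectral_radius r p H'"
proof -
  obtain f where f: "bij_betw f (verts H) (verts H')" and E: "edges H' = (\<lambda>e. f ` e) ` edges H"
    using iso by (auto simp: hypergraph_iso_def)
  have inj: "inj_on f (verts H)" and img: "f ` verts H = verts H'"
    using f by (auto simp: bij_betw_def)
  note sub = uniform_finite(4)[OF H]
  have norm: "p_norm_on (verts H') p y = p_norm_on (verts H) p (y \<circ> f)" for y
    unfolding p_norm_on_def img[symmetric] by (simp add: sum.reindex[OF inj])
  have poly: "(\<Sum>e\<in>edges H'. \<Prod>i\<in>e. y i) = (\<Sum>e\<in>edges H. \<Prod>i\<in>e. (y \<circ> f) i)" for y :: "_ \<Rightarrow> real"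
  proof -
    have "inj_on (\<lambda>e. f ` e) (edges H)"
      using inj_on_image_Pow[OF inj] sub by (auto intro: inj_on_subset)
    then have "(\<Sum>e\<in>edges H'. \<Prod>i\<in>e. y i) = (\<Sum>e\<in>edges H. \<Prod>i\<in>f ` e. y i)"
      unfolding E by (simp add: sum.reindex)
    also have "\<dots> = (\<Sum>e\<in>edges H. \<Prod>i\<in>e. (y \<circ> f) i)"
      using sub by (intro sum.cong refl) (simp add: prod.reindex inj_on_subset[OF inj])
    finally show ?thesis .
  qed
  have "(\<exists>x. p_norm_on (verts H) p x = 1 \<and> t = real r * (\<Sum>e\<in>edges H. \<Prod>i\<in>e. x i)) \<longleftrightarrow>
      (\<exists>y. p_norm_on (verts H') p y = 1 \<and> t = real r * (\<Sum>e\<in>edges H'. \<Prod>i\<in>e. y i))" for t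
  proof
    assume "\<exists>x. p_norm_on (verts H) p x = 1 \<and> t = real r * (\<Sum>e\<in>edges H. \<Prod>i\<in>e. x i)"
    then obtain x where x: "p_norm_on (verts H) p x = 1" "t = real r * (\<Sum>e\<in>edges H. \<Prod>i\<in>e. x i)"
      by blast
    let ?y = "x \<circ> the_inv_into (verts H) f"
    have undo_f: "(?y \<circ> f) i = x i" if "i \<in> verts H" for i
      using the_inv_into_f_f[OF inj that] by simp
    have "p_norm_on (verts H) p (?y \<circ> f) = p_norm_on (verts H) p x"
      unfolding p_norm_on_def using undo_f by simp
    moreover have "(\<Sum>e\<in>edges H. \<Prod>i\<in>e. (?y \<circ> f) i) = (\<Sum>e\<in>edges H. \<Prod>i\<in>e. x i)"
      using undo_f sub by (intro sum.cong prod.cong refl) blast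
    ultimately show "\<exists>y. p_norm_on (verts H') p y = 1 \<and> t = real r * (\<Sum>e\<in>edges H'. \<Prod>i\<in>e. y i)"
      using x by (intro exI[of _ ?y]) (simp only: norm poly)
  qed (metis norm poly)
  then show ?thesis by (simp add: p_spectral_radius_def)
qed

lemma p_norm_on_mono: "finite V \<Longrightarrow> T \<subseteq> V \<Longrightarrow> 1 \<le> p \<Longrightarrow> p_norm_on T p x \<le> p_norm_on V p x"
  unfolding p_norm_on_def by (intro powr_mono2 sum_mono2 sum_nonneg) auto

text \<open>
  The edge sum is homogeneous of degree \<open>r\<close>, so the maximality of the radius on the unit sphere
  extends to all vectors. For the zero vector this uses that edges are nonempty.
\<close>

lemma edge_sum_le_radius_norm:
  assumes H: "uniform_hypergraph r H" and ne: "verts H \<noteq> {}" and p: "1 \<le> p" and r: "1 \<le> r"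
  shows "real r * edge_sum H x \<le> p_spectral_radius r p H * p_norm_on (verts H) p x ^ r"
proof -
  note fin = uniform_finite[OF H]
  let ?N = "p_norm_on (verts H) p x"
  have N0: "0 \<le> ?N" by (simp add: p_norm_on_def)
  show ?thesis
  proof (cases "?N = 0")
    case True
    then have "(\<Sum>i\<in>verts H. \<bar>x i\<bar> powr p) = 0"
      by (simp add: p_norm_on_def)
    then have "\<bar>x i\<bar> powr p = 0" if "i \<in> verts H" for i
      using sum_nonneg_eq_0_iff[of "verts H" "\<lambda>i. \<bar>x i\<bar> powr p"] fin that by auto
    then have "x i = 0" if "i \<in> verts H" for i using that by auto
    then have "(\<Prod>i\<in>e. x i) = 0" if "e \<in> edges H" for e
    proof -
      have "e \<noteq> {}" using fin(5)[OF that] r by auto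
      then obtain i where "i \<in> e" by blast
      then show ?thesis using \<open>\<And>i. i \<in> verts H \<Longrightarrow> x i = 0\<close> fin(3,4)[OF that] by (intro prod_zero) auto
    qed
    then show ?thesis using True r by (simp add: edge_sum_def power_0_left)
  next
    case False
    then have N: "0 < ?N" using N0 by simp
    let ?y = "\<lambda>i. x i / ?N"
    have pow: "?N powr p = (\<Sum>i\<in>verts H. \<bar>x i\<bar> powr p)"
      using p by (simp add: p_norm_on_def powr_powr sum_nonneg)
    have "p_norm_on (verts H) p ?y = 1"
    proof -
      have "(\<Sum>i\<in>verts H. \<bar>?y i\<bar> powr p) = (\<Sum>i\<in>verts H. \<bar>x i\<bar> powr p / ?N powr p)"
        using N by (intro sum.cong refl) (simp add: powr_divide)
      also have "\<dots> = (\<Sum>i\<in>verts H. \<bar>x i\<bar> powr p) / ?N powr p" by (simp add: sum_divide_distrib)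
      also have "\<dots> = 1" using N by (simp flip: pow)
      finally show ?thesis by (simp add: p_norm_on_def)
    qed
    from p_spectral_radius_attained(2)[OF H ne p this]
    have "real r * (\<Sum>e\<in>edges H. \<Prod>i\<in>e. x i / ?N) \<le> p_spectral_radius r p H" .
    also have "(\<Sum>e\<in>edges H. \<Prod>i\<in>e. x i / ?N) = edge_sum H x / ?N ^ r"
      unfolding edge_sum_def sum_divide_distrib
      using fin by (intro sum.cong refl) (simp add: prod_dividef)
    finally show ?thesis using N by (simp add: field_simps)
  qed
qed

text \<open>
  Passing to absolute values keeps the norm and does not decrease the edge sum.
\<close>

lemma nonneg_maximiser:
  assumes H: "uniform_hypergraph r H" and ne: "verts H \<noteq> {}" and p: "1 \<le> p"
  obtains x where "\<And>i. 0 \<le> x i" "p_norm_on (verts H) p x = 1"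
    "p_spectral_radius r p H = real r * edge_sum H x"
proof -
  obtain x where x: "p_norm_on (verts H) p x = 1"
    "p_spectral_radius r p H = real r * (\<Sum>e\<in>edges H. \<Prod>i\<in>e. x i)"
    using p_spectral_radius_attained(1)[OF H ne p] by blast
  have norm: "p_norm_on (verts H) p (\<lambda>i. \<bar>x i\<bar>) = 1" using x by (simp add: p_norm_on_def)
  have "(\<Sum>e\<in>edges H. \<Prod>i\<in>e. x i) \<le> (\<Sum>e\<in>edges H. \<Prod>i\<in>e. \<bar>x i\<bar>)"
    by (intro sum_mono) (simp add: abs_prod[symmetric])
  then have "p_spectral_radius r p H \<le> real r * (\<Sum>e\<in>edges H. \<Prod>i\<in>e. \<bar>x i\<bar>)"
    by (simp add: x(2) mult_left_mono)
  with p_spectral_radius_attained(2)[OF H ne p norm] norm show ?thesis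
    by (intro that[of "\<lambda>i. \<bar>x i\<bar>"]) (auto simp: edge_sum_def)
qed

text \<open>
  The edge sum is affine in each single weight, with the link sum as its slope.
\<close>

lemma edge_sum_update:
  assumes H: "uniform_hypergraph r H"
  shows "edge_sum H (x(v := t)) =
    (\<Sum>e\<in>{e\<in>edges H. v \<notin> e}. \<Prod>i\<in>e. x i) + t * link_sum H x v"
proof -
  note fin = uniform_finite[OF H]
  have "edge_sum H (x(v := t)) = (\<Sum>e\<in>{e\<in>edges H. v \<notin> e}. \<Prod>i\<in>e. (x(v := t)) i) +
      (\<Sum>e\<in>{e\<in>edges H. v \<in> e}. \<Prod>i\<in>e. (x(v := t)) i)"
    unfolding edge_sum_def using fin(2)
    by (subst sum.union_disjoint[symmetric]) (auto intro!: sum.cong)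
  also have "(\<Sum>e\<in>{e\<in>edges H. v \<notin> e}. \<Prod>i\<in>e. (x(v := t)) i) =
      (\<Sum>e\<in>{e\<in>edges H. v \<notin> e}. \<Prod>i\<in>e. x i)"
    by (intro sum.cong prod.cong refl) auto
  also have "(\<Sum>e\<in>{e\<in>edges H. v \<in> e}. \<Prod>i\<in>e. (x(v := t)) i) =
      (\<Sum>e\<in>{e\<in>edges H. v \<in> e}. t * (\<Prod>i\<in>e - {v}. x i))"
  proof (rule sum.cong)
    fix e assume e: "e \<in> {e\<in>edges H. v \<in> e}"
    then have "(\<Prod>i\<in>e. (x(v := t)) i) = (x(v := t)) v * (\<Prod>i\<in>e - {v}. (x(v := t)) i)"
      using fin(3) by (intro prod.remove) auto
    also have "(\<Prod>i\<in>e - {v}. (x(v := t)) i) = (\<Prod>i\<in>e - {v}. x i)"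
      by (intro prod.cong) auto
    finally show "(\<Prod>i\<in>e. (x(v := t)) i) = t * (\<Prod>i\<in>e - {v}. x i)" by simp
  qed simp
  finally show ?thesis by (simp only: link_sum_def sum_distrib_left)
qed

text \<open>
  The Lagrange condition at a vertex with positive weight. In place of a constrained variation, one
  weight \<open>t\<close> is varied freely: the difference of the two sides of \<open>edge_sum_le_radius_norm\<close> is
  nonnegative and vanishes at \<open>t = x v\<close>, so its derivative there is zero.
\<close>

lemma eigen_equation:
  assumes H: "uniform_hypergraph r H" and p: "1 \<le> p" and r: "1 \<le> r"
    and x: "p_norm_on (verts H) p x = 1" "p_spectral_radius r p H = real r * edge_sum H x"
    and v: "v \<in> verts H" "0 < x v"
  shows "p_spectral_radius r p H * x v powr (p - 1) = link_sum H x v"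
proof -
  let ?L = "p_spectral_radius r p H"
  have ne: "verts H \<noteq> {}" using v by blast
  have finV: "finite (verts H)" by (rule uniform_finite(1)[OF H])
  define A where "A = (\<Sum>e\<in>{e\<in>edges H. v \<notin> e}. \<Prod>i\<in>e. x i)"
  define C where "C = (\<Sum>i\<in>verts H - {v}. \<bar>x i\<bar> powr p)"
  have C0: "0 \<le> C" by (simp add: C_def sum_nonneg)
  have norm: "p_norm_on (verts H) p (x(v := t)) = (C + t powr p) powr (1 / p)" if "0 < t" for t
  proof -
    have "(\<Sum>i\<in>verts H. \<bar>(x(v := t)) i\<bar> powr p) = t powr p + (\<Sum>i\<in>verts H - {v}. \<bar>(x(v := t)) i\<bar> powr p)"
      using finV v that by (subst sum.remove[of _ v]) auto
    also have "(\<Sum>i\<in>verts H - {v}. \<bar>(x(v := t)) i\<bar> powr p) = C"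
      unfolding C_def by (intro sum.cong) auto
    finally show ?thesis by (simp add: p_norm_on_def add.commute)
  qed
  define \<phi> where "\<phi> t = ?L * (C + t powr p) powr (r / p) - r * (A + t * link_sum H x v)" for t
  have norm_pow: "p_norm_on (verts H) p (x(v := t)) ^ r = (C + t powr p) powr (r / p)" if "0 < t" for t
  proof -
    have "0 < C + t powr p" using C0 that by (simp add: add_nonneg_pos)
    then show ?thesis using that by (simp add: norm powr_realpow[symmetric] powr_powr)
  qed
  have nonneg: "0 \<le> \<phi> t" if "0 < t" for t
    using edge_sum_le_radius_norm[OF H ne p r, of "x(v := t)"]
    by (simp add: \<phi>_def norm_pow[OF that] edge_sum_update[OF H] A_def)
  have "x(v := x v) = x" by simp
  then have total: "C + x v powr p = 1"
  proof -
    have "(C + x v powr p) powr (1 / p) = 1" using norm[OF v(2)] x(1) by simp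
    then have "((C + x v powr p) powr (1 / p)) powr p = 1" by simp
    then show ?thesis using p C0 by (simp add: powr_powr)
  qed
  have zero: "\<phi> (x v) = 0"
    using edge_sum_update[OF H, of x v "x v"] x(2) by (simp add: \<phi>_def total A_def)
  have "(\<phi> has_real_derivative
      ?L * ((r / p) * (C + x v powr p) powr (r / p - 1) * (p * x v powr (p - 1))) - r * link_sum H x v) (at (x v))"
    unfolding \<phi>_def using v total p by (auto intro!: derivative_eq_intros simp: mult_ac)
  then have "(\<phi> has_real_derivative r * (?L * x v powr (p - 1) - link_sum H x v)) (at (x v))"
    using p by (simp add: total algebra_simps)
  moreover have "\<forall>y. \<bar>x v - y\<bar> < x v \<longrightarrow> \<phi> (x v) \<le> \<phi> y"
    using nonneg zero by auto
  ultimately have "r * (?L * x v powr (p - 1) - link_sum H x v) = 0"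
    using DERIV_local_min v(2) by blast
  then show ?thesis using r by simp
qed

text \<open>
  Convexity: on the unit interval a power of \<open>1 + y\<close> lies below its chord.
\<close>

lemma one_plus_power_le:
  fixes y :: real
  assumes "0 \<le> y" "y \<le> 1"
  shows "(1 + y) ^ n \<le> 1 + (2 ^ n - 1) * y"
proof (induction n)
  case (Suc n)
  have "(1 + y) ^ Suc n \<le> (1 + y) * (1 + (2 ^ n - 1) * y)"
    using Suc assms by (simp add: mult_left_mono)
  also have "\<dots> = 1 + y + (2 ^ n - 1) * y + (2 ^ n - 1) * (y * y)" by (simp add: algebra_simps)
  also have "\<dots> \<le> 1 + y + (2 ^ n - 1) * y + (2 ^ n - 1) * y"
    using assms by (intro add_left_mono mult_left_mono) (auto simp: mult_left_le)
  finally show ?case by (simp add: algebra_simps)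
qed simp

text \<open>
  If some weights vanish, connectedness gives an edge with both zero and nonzero weights. Raising its
  zero weights to \<open>\<epsilon>\<close> adds at least a multiple of \<open>\<epsilon>\<close> to the power \<open>r - 1\<close> to the edge sum, while the
  \<open>p\<close>-th power of the norm grows by a multiple of \<open>\<epsilon> powr p\<close>. For \<open>p > r - 1\<close> and small \<open>\<epsilon>\<close> the gain
  wins.
\<close>

lemma maximiser_positive:
  assumes H: "uniform_hypergraph r H" and p: "1 \<le> p" "real r - 1 < p" and r: "1 \<le> r"
    and x: "\<And>i. 0 \<le> x i" "p_norm_on (verts H) p x = 1" "p_spectral_radius r p H = real r * edge_sum H x"
    and connected: "\<And>Z. Z \<subseteq> verts H \<Longrightarrow> Z \<noteq> {} \<Longrightarrow> Z \<noteq> verts H \<Longrightarrow>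
      \<exists>e\<in>edges H. e \<inter> Z \<noteq> {} \<and> \<not> e \<subseteq> Z"
    and v: "v \<in> verts H"
  shows "0 < x v"
proof (rule ccontr)
  assume "\<not> 0 < x v"
  then have v0: "x v = 0" using x(1)[of v] by simp
  note fin = uniform_finite[OF H]
  let ?L = "p_spectral_radius r p H"
  define Z where "Z = {i\<in>verts H. x i = 0}"
  have ne: "verts H \<noteq> {}" using v by blast
  have normp: "(\<Sum>i\<in>verts H. \<bar>x i\<bar> powr p) = 1"
  proof -
    have "((\<Sum>i\<in>verts H. \<bar>x i\<bar> powr p) powr (1 / p)) powr p = 1"
      using x(2) by (simp add: p_norm_on_def)
    then show ?thesis using p by (simp add: powr_powr sum_nonneg)
  qed
  have "Z \<noteq> verts H"
  proof
    assume "Z = verts H"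
    then have "(\<Sum>i\<in>verts H. \<bar>x i\<bar> powr p) = 0" by (intro sum.neutral) (auto simp: Z_def)
    then show False using normp by simp
  qed
  then obtain e where e: "e \<in> edges H" "e \<inter> Z \<noteq> {}" "\<not> e \<subseteq> Z"
    using connected[of Z] v v0 by (auto simp: Z_def)
  note fe = fin(3)[OF e(1)]
  define m where "m = card (e \<inter> Z)"
  define c where "c = (\<Prod>i\<in>e - Z. x i)"
  have m: "m \<le> r - 1"
  proof -
    have "m < card e" unfolding m_def using e fe by (intro psubset_card_mono) auto
    then show ?thesis using fin(5)[OF e(1)] by simp
  qed
  have c: "0 < c"
    unfolding c_def using x(1) fin(4)[OF e(1)] by (intro prod_pos) (auto simp: Z_def less_le)
  have L0: "0 \<le> ?L" using x(1,3) by (simp add: edge_sum_def sum_nonneg prod_nonneg)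
  have key: "r * c \<le> ?L * (2 ^ r * m) * \<epsilon> powr (p - (real r - 1))"
    if \<epsilon>: "0 < \<epsilon>" "\<epsilon> < 1" "m * \<epsilon> powr p \<le> 1" for \<epsilon>
  proof -
    define y where "y i = (if i \<in> e \<inter> Z then \<epsilon> else x i)" for i
    have mono: "x i \<le> y i" if "i \<in> verts H" for i
      using that \<epsilon> by (auto simp: y_def Z_def)
    have "(\<Prod>i\<in>e. y i) = (\<Prod>i\<in>e \<inter> Z. y i) * (\<Prod>i\<in>e - Z. y i)"
      using fe by (subst prod.Int_Diff[of e _ Z]) auto
    also have "\<dots> = \<epsilon> ^ m * c"
      by (simp add: y_def m_def c_def)
    finally have ye: "(\<Prod>i\<in>e. y i) = \<epsilon> ^ m * c" .
    have xe: "(\<Prod>i\<in>e. x i) = 0" using e fe by (intro prod_zero) (auto simp: Z_def)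
    have "edge_sum H x = (\<Sum>e\<in>edges H - {e}. \<Prod>i\<in>e. x i)"
      unfolding edge_sum_def using fin(2) e(1) xe by (simp add: sum.remove)
    also have "\<dots> \<le> (\<Sum>e\<in>edges H - {e}. \<Prod>i\<in>e. y i)"
      using x(1) mono fin(4) by (intro sum_mono prod_mono) blast
    also have "\<dots> = edge_sum H y - \<epsilon> ^ m * c"
      unfolding edge_sum_def using fin(2) e(1) ye by (simp add: sum.remove)
    finally have gain: "edge_sum H x + \<epsilon> ^ m * c \<le> edge_sum H y" by simp
    have "(\<Sum>i\<in>verts H. \<bar>y i\<bar> powr p) =
        (\<Sum>i\<in>verts H. \<bar>x i\<bar> powr p + (if i \<in> e \<inter> Z then \<epsilon> powr p else 0))"
      using \<epsilon> by (intro sum.cong refl) (auto simp: y_def Z_def)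
    also have "\<dots> = 1 + (\<Sum>i\<in>verts H. if i \<in> e \<inter> Z then \<epsilon> powr p else 0)"
      by (simp add: sum.distrib normp)
    also have "(\<Sum>i\<in>verts H. if i \<in> e \<inter> Z then \<epsilon> powr p else 0) = m * \<epsilon> powr p"
    proof -
      have "verts H \<inter> {i. i \<in> e \<inter> Z} = e \<inter> Z" using fin(4)[OF e(1)] by auto
      then show ?thesis using fin(1) by (simp add: sum.If_cases m_def)
    qed
    finally have normy: "(\<Sum>i\<in>verts H. \<bar>y i\<bar> powr p) = 1 + m * \<epsilon> powr p" .
    have "p_norm_on (verts H) p y \<le> (1 + m * \<epsilon> powr p) powr 1"
      unfolding p_norm_on_def normy using p by (intro powr_mono) auto
    then have "p_norm_on (verts H) p y ^ r \<le> (1 + m * \<epsilon> powr p) ^ r"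
      by (intro power_mono) (auto simp: p_norm_on_def)
    also have "\<dots> \<le> 1 + (2 ^ r - 1) * (m * \<epsilon> powr p)" using \<epsilon> by (intro one_plus_power_le) auto
    also have "\<dots> \<le> 1 + 2 ^ r * (m * \<epsilon> powr p)" by (intro add_left_mono mult_right_mono) auto
    finally have "r * edge_sum H y \<le> ?L * (1 + 2 ^ r * (m * \<epsilon> powr p))"
      using order.trans[OF edge_sum_le_radius_norm[OF H ne p(1) r] mult_left_mono[OF _ L0]] by blast
    then have "r * edge_sum H y \<le> ?L + ?L * (2 ^ r * m) * \<epsilon> powr p"
      by (simp add: distrib_left mult.assoc)
    moreover have "?L + r * (\<epsilon> ^ m * c) \<le> r * edge_sum H y"
      using mult_left_mono[OF gain, of "real r"] x(3) by (simp add: distrib_left)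
    ultimately have "r * (\<epsilon> ^ m * c) \<le> ?L * (2 ^ r * m) * \<epsilon> powr p" by linarith
    moreover have "r * (\<epsilon> ^ (r - 1) * c) \<le> r * (\<epsilon> ^ m * c)"
      using \<epsilon> c m by (intro mult_left_mono mult_right_mono power_decreasing) auto
    ultimately have "r * c * \<epsilon> ^ (r - 1) \<le> ?L * (2 ^ r * m) * \<epsilon> powr p" by (simp add: mult_ac)
    also have "\<epsilon> powr p = \<epsilon> powr (p - (real r - 1)) * \<epsilon> ^ (r - 1)"
      using \<epsilon> r by (simp add: powr_realpow[symmetric] powr_add[symmetric] of_nat_diff)
    finally show ?thesis using \<epsilon> by (simp add: mult.assoc[symmetric])
  qed
  have vanish: "((\<lambda>\<epsilon>. \<epsilon> powr s) \<longlongrightarrow> 0) (at_right (0::real))" if "0 < s" for s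
    using that by (intro tendsto_zero_powrI[where b = s])
      (auto intro: tendsto_ident_at simp: eventually_at_right_less eventually_mono[OF eventually_at_right_less])
  have "((\<lambda>\<epsilon>. m * \<epsilon> powr p) \<longlongrightarrow> real m * 0) (at_right 0)"
    using p vanish[of p] by (intro tendsto_mult tendsto_const) auto
  then have "eventually (\<lambda>\<epsilon>. m * \<epsilon> powr p < 1) (at_right 0)"
    by (rule order_tendstoD) simp
  moreover have "eventually (\<lambda>\<epsilon>::real. \<epsilon> < 1) (at_right 0)"
    by (rule eventually_at_right_real[of 0 1, THEN eventually_mono]) auto
  moreover have "eventually (\<lambda>\<epsilon>::real. 0 < \<epsilon>) (at_right 0)"
    by (simp add: eventually_at_right_less)
  ultimately have ev: "eventually (\<lambda>\<epsilon>. r * c \<le> ?L * (2 ^ r * m) * \<epsilon> powr (p - (real r - 1))) (at_right 0)"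
    by eventually_elim (rule key, simp_all)
  have "((\<lambda>\<epsilon>. ?L * (2 ^ r * m) * \<epsilon> powr (p - (real r - 1))) \<longlongrightarrow> ?L * (2 ^ r * m) * 0) (at_right 0)"
    using p vanish[of "p - (real r - 1)"] by (intro tendsto_mult tendsto_const) auto
  from tendsto_lowerbound[OF this ev] have "r * c \<le> 0" by simp
  then show False using c r by (simp add: mult_le_0_iff)
qed

section \<open>Comparing sums of products by counting\<close>

text \<open>
  Abel summation: the weight \<open>a m\<close> is the last weight \<open>a M\<close> plus the drops at the levels from \<open>m\<close> on,
  so a weighted sum depends only on the partial sums up to each level.
\<close>

lemma sum_by_layers:
  fixes a :: "nat \<Rightarrow> real" and c :: "'i \<Rightarrow> real"
  assumes I: "finite I" and M: "\<And>i. i \<in> I \<Longrightarrow> \<alpha> i \<le> M"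
  shows "(\<Sum>i\<in>I. c i * a (\<alpha> i)) =
    a M * (\<Sum>i\<in>{i\<in>I. \<alpha> i \<le> M}. c i) +
    (\<Sum>s<M. (a s - a (Suc s)) * (\<Sum>i\<in>{i\<in>I. \<alpha> i \<le> s}. c i))"
proof -
  have tel: "a m = a M + (\<Sum>s<M. if m \<le> s then a s - a (Suc s) else 0)" if "m \<le> M" for m
    using that by (induction M rule: dec_induct) (auto simp: sum.neutral)
  have "(\<Sum>i\<in>I. c i * a (\<alpha> i)) =
      (\<Sum>i\<in>I. c i * a M + (\<Sum>s<M. (a s - a (Suc s)) * (if \<alpha> i \<le> s then c i else 0)))"
  proof (rule sum.cong)
    fix i assume "i \<in> I"
    then have "c i * a (\<alpha> i) =
        c i * (a M + (\<Sum>s<M. if \<alpha> i \<le> s then a s - a (Suc s) else 0))"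
      using tel[OF M] by simp
    also have "\<dots> = c i * a M + (\<Sum>s<M. (a s - a (Suc s)) * (if \<alpha> i \<le> s then c i else 0))"
      by (simp add: distrib_left sum_distrib_left if_distrib mult.commute cong: if_cong)
    finally show "c i * a (\<alpha> i) = \<dots>" .
  qed simp
  also have "\<dots> = a M * (\<Sum>i\<in>I. c i) +
      (\<Sum>s<M. \<Sum>i\<in>I. (a s - a (Suc s)) * (if \<alpha> i \<le> s then c i else 0))"
    by (subst sum.distrib, subst sum.swap) (simp add: sum_distrib_left mult.commute)
  also have "\<dots> = a M * (\<Sum>i\<in>{i\<in>I. \<alpha> i \<le> M}. c i) +
    (\<Sum>s<M. (a s - a (Suc s)) * (\<Sum>i\<in>{i\<in>I. \<alpha> i \<le> s}. c i))"
  proof -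
    have "{i \<in> I. \<alpha> i \<le> M} = I" using M by auto
    then show ?thesis
      by (simp add: sum_distrib_left[symmetric] sum.inter_filter[OF I])
  qed
  finally show ?thesis .
qed

lemma weighted_sum_dominated:
  fixes a :: "nat \<Rightarrow> real" and c :: "'i \<Rightarrow> real" and d :: "'j \<Rightarrow> real"
  assumes I: "finite I" and J: "finite J" and a: "decseq a" "\<And>n. 0 \<le> a n"
    and le: "\<And>s. (\<Sum>i\<in>{i\<in>I. \<alpha> i \<le> s}. c i) \<le> (\<Sum>j\<in>{j\<in>J. \<beta> j \<le> s}. d j)"
  shows "(\<Sum>i\<in>I. c i * a (\<alpha> i)) \<le> (\<Sum>j\<in>J. d j * a (\<beta> j))"
proof -
  obtain M where M: "\<And>i. i \<in> I \<Longrightarrow> \<alpha> i \<le> M" "\<And>j. j \<in> J \<Longrightarrow> \<beta> j \<le> M"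
  proof -
    have "finite (\<alpha> ` I \<union> \<beta> ` J)" using I J by simp
    then obtain M where "\<forall>n \<in> \<alpha> ` I \<union> \<beta> ` J. n \<le> M"
      by (auto simp: finite_nat_set_iff_bounded_le)
    then show ?thesis by (intro that[of M]) auto
  qed
  show ?thesis
    using a le
    by (simp only: sum_by_layers[where M = M and a = a and c = c, OF I M(1)]
        sum_by_layers[where M = M and a = a and c = d, OF J M(2)])
       (intro add_mono sum_mono mult_left_mono, auto simp: decseq_SucD)
qed

text \<open>
  The one-dimensional comparison is applied twice: once in the left index, with the weights of the
  right indices as coefficients, and once to compare the coefficient sums that arise.
\<close>

lemma sum_products_dominated_ordered:
  fixes a :: "nat \<Rightarrow> real"
  assumes I: "finite I" and J: "finite J" and a: "decseq a" "\<And>n. 0 \<le> a n"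
    and le: "\<And>s t. card {i\<in>I. l i \<le> s \<and> r i \<le> t} \<le> card {j\<in>J. l' j \<le> s \<and> r' j \<le> t}"
  shows "(\<Sum>i\<in>I. a (l i) * a (r i)) \<le> (\<Sum>j\<in>J. a (l' j) * a (r' j))"
proof (rule weighted_sum_dominated[OF I J a])
  fix t
  have "(\<Sum>i\<in>{i\<in>I. r i \<le> t}. 1 * a (l i)) \<le> (\<Sum>j\<in>{j\<in>J. r' j \<le> t}. 1 * a (l' j))"
  proof (rule weighted_sum_dominated[OF _ _ a])
    fix s
    have "{i \<in> {i \<in> I. r i \<le> t}. l i \<le> s} = {i\<in>I. l i \<le> s \<and> r i \<le> t}"
      "{j \<in> {j \<in> J. r' j \<le> t}. l' j \<le> s} = {j\<in>J. l' j \<le> s \<and> r' j \<le> t}" by auto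
    then show "(\<Sum>i\<in>{i \<in> {i \<in> I. r i \<le> t}. l i \<le> s}. 1) \<le>
        (\<Sum>j\<in>{j \<in> {j \<in> J. r' j \<le> t}. l' j \<le> s}. 1::real)"
      using le[of s t] by simp
  qed (use I J in auto)
  then show "(\<Sum>i\<in>{i\<in>I. r i \<le> t}. a (l i)) \<le> (\<Sum>j\<in>{j\<in>J. r' j \<le> t}. a (l' j))" by simp
qed

text \<open>
  For undirected edges both orientations are counted. This makes the count symmetric in \<open>s\<close> and \<open>t\<close>,
  which is why only \<open>s \<le> t\<close> has to be checked.
\<close>

lemma sum_products_dominated:
  fixes a :: "nat \<Rightarrow> real"
  assumes I: "finite I" and J: "finite J" and a: "decseq a" "\<And>n. 0 \<le> a n"
    and le: "\<And>s t. s \<le> t \<Longrightarrow>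
      card {i\<in>I. l i \<le> s \<and> r i \<le> t} + card {i\<in>I. r i \<le> s \<and> l i \<le> t} \<le>
      card {j\<in>J. l' j \<le> s \<and> r' j \<le> t} + card {j\<in>J. r' j \<le> s \<and> l' j \<le> t}"
  shows "(\<Sum>i\<in>I. a (l i) * a (r i)) \<le> (\<Sum>j\<in>J. a (l' j) * a (r' j))"
proof -
  have double: "(\<Sum>i\<in>K <+> K. a (case_sum f g i) * a (case_sum g f i)) = 2 * (\<Sum>i\<in>K. a (f i) * a (g i))"
    if "finite K" for K :: "'k set" and f g :: "'k \<Rightarrow> nat"
    using that by (simp add: sum.Plus mult.commute)
  have count: "card {i\<in>K <+> K. case_sum f g i \<le> s \<and> case_sum g f i \<le> t} =
      card {i\<in>K. f i \<le> s \<and> g i \<le> t} + card {i\<in>K. g i \<le> s \<and> f i \<le> t}"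
    if "finite K" for K :: "'k set" and f g :: "'k \<Rightarrow> nat" and s t
  proof -
    have "{i\<in>K <+> K. case_sum f g i \<le> s \<and> case_sum g f i \<le> t} =
        {i\<in>K. f i \<le> s \<and> g i \<le> t} <+> {i\<in>K. g i \<le> s \<and> f i \<le> t}"
      unfolding Plus_def by auto
    then show ?thesis using that by (simp add: card_Plus)
  qed
  have "(\<Sum>i\<in>I <+> I. a (case_sum l r i) * a (case_sum r l i)) \<le>
      (\<Sum>j\<in>J <+> J. a (case_sum l' r' j) * a (case_sum r' l' j))"
  proof (rule sum_products_dominated_ordered[OF _ _ a])
    fix s t
    show "card {i \<in> I <+> I. case_sum l r i \<le> s \<and> case_sum r l i \<le> t} \<le>
        card {j \<in> J <+> J. case_sum l' r' j \<le> s \<and> case_sum r' l' j \<le> t}"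
      unfolding count[OF I] count[OF J]
      using le[of s t] le[of t s] by (cases "s \<le> t") (simp_all add: conj_commute add.commute)
  qed (use I J in auto)
  then show ?thesis unfolding double[OF I] double[OF J] by simp
qed

section \<open>The extremal graph in sorted position\<close>

text \<open>
  The graph \<open>\<Delta>\<^sub>2\<close> with its vertices ranked \<open>1, \<dots>, k - 1\<close> by decreasing weight; the rank 0 is kept for
  the vertex that suspends it. The shared vertex is 1, the triangle is \<open>1, 2, 3\<close>, and the long cycle
  runs from 1 through the even ranks \<open>4, 6, \<dots>\<close> upwards and back to 1 through the odd ranks
  \<open>\<dots>, 7, 5\<close>; the edge with index \<open>k - 1\<close> joins the two branches. The indices are arranged such that
  initial segments of edges lie on initial segments of vertices.
\<close>

definition core_l :: "nat \<Rightarrow> nat" where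
  "core_l j = (if j \<in> {0, 1, 3, 4} then 1 else if j = 2 then 2 else j - 1)"

definition core_r :: "nat \<Rightarrow> nat \<Rightarrow> nat" where
  "core_r k j = (if j = 0 then 2 else if j \<in> {1, 2} then 3 else if j = k - 1 then k - 1 else j + 1)"

definition core_count :: "nat \<Rightarrow> nat \<Rightarrow> nat \<Rightarrow> nat" where
  "core_count k s t = card {j\<in>{..<k}. core_l j \<le> s \<and> core_r k j \<le> t} +
     card {j\<in>{..<k}. core_r k j \<le> s \<and> core_l j \<le> t}"

lemma core_count_ge:
  assumes "\<And>j. j \<in> A \<Longrightarrow> j < k \<and> core_l j \<le> s \<and> core_r k j \<le> t"
    and "\<And>j. j \<in> B \<Longrightarrow> j < k \<and> core_r k j \<le> s \<and> core_l j \<le> t"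
  shows "card A + card B \<le> core_count k s t"
  unfolding core_count_def using assms by (intro add_mono card_mono) auto

lemma core_l_le: "j \<le> s + 1 \<Longrightarrow> 2 \<le> s \<Longrightarrow> core_l j \<le> s"
  by (cases "j = 2") (auto simp: core_l_def)

lemma core_r_le: "j < t \<Longrightarrow> 3 \<le> t \<Longrightarrow> core_r k j \<le> t"
  by (simp add: core_r_def)

lemma core_r_le_last: "j < k \<Longrightarrow> 6 \<le> k \<Longrightarrow> core_r k j \<le> k - 1"
  unfolding core_r_def by (auto split: if_splits)

lemma core_small:
  "core_l 0 = 1" "core_l (Suc 0) = 1" "core_l 2 = 2" "core_l 3 = 1" "core_l 4 = 1"
  "core_r k 0 = 2" "core_r k (Suc 0) = 3" "core_r k 2 = 3"
  "6 \<le> k \<Longrightarrow> core_r k 3 = 4" "6 \<le> k \<Longrightarrow> core_r k 4 = 5"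
  by (simp_all add: core_l_def core_r_def)

text \<open>
  The counts are bounded from below by exhibiting edges. For \<open>s \<ge> 3\<close> initial segments of the edge
  indices suffice; the bounds for \<open>s \<le> 2\<close> are smaller because so few vertices span few edges. The
  alternative \<open>t = k - 1\<close> in the fourth bound covers \<open>s = k - 2\<close>, where the last two ranks are adjacent.
\<close>

lemma core_count_lower:
  assumes k: "6 \<le> k" and st: "s \<le> t"
  shows "k - 1 \<le> s \<Longrightarrow> 2 * k \<le> core_count k s t"
    and "3 \<le> s \<Longrightarrow> s \<le> k - 2 \<Longrightarrow> t = s \<Longrightarrow> 2 * s \<le> core_count k s t"
    and "3 \<le> s \<Longrightarrow> s \<le> k - 3 \<Longrightarrow> t = s + 1 \<Longrightarrow> 2 * s + 1 \<le> core_count k s t"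
    and "3 \<le> s \<Longrightarrow> s \<le> k - 2 \<Longrightarrow> s + 2 \<le> t \<or> t = k - 1 \<Longrightarrow> s < t \<Longrightarrow> 2 * s + 2 \<le> core_count k s t"
    and "s = 2 \<Longrightarrow> t = 2 \<Longrightarrow> 2 \<le> core_count k s t"
    and "s = 2 \<Longrightarrow> t = 3 \<Longrightarrow> 4 \<le> core_count k s t"
    and "s = 2 \<Longrightarrow> t = 4 \<Longrightarrow> 5 \<le> core_count k s t"
    and "s = 2 \<Longrightarrow> 5 \<le> t \<Longrightarrow> 6 \<le> core_count k s t"
    and "s = 1 \<Longrightarrow> min (t - 1) 4 \<le> core_count k s t"
proof -
  show "2 * k \<le> core_count k s t" if "k - 1 \<le> s"
  proof -
    have "card {..<k} + card {..<k} \<le> core_count k s t"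
      proof (rule core_count_ge)
      fix j assume "j \<in> {..<k}"
      then show "j < k \<and> core_l j \<le> s \<and> core_r k j \<le> t" "j < k \<and> core_r k j \<le> s \<and> core_l j \<le> t"
        using core_r_le_last[of j k] le_trans[OF core_l_le[of j s] st] core_l_le[of j s] that k st by auto
    qed
    then show ?thesis by simp
  qed
  show "2 * s \<le> core_count k s t" if "3 \<le> s" "s \<le> k - 2" "t = s"
  proof -
    have "card {..<s} + card {..<s} \<le> core_count k s t"
      by (rule core_count_ge) (use that k st in \<open>auto intro: core_l_le core_r_le\<close>)
    then show ?thesis by simp
  qed
  show "2 * s + 1 \<le> core_count k s t" if "3 \<le> s" "s \<le> k - 3" "t = s + 1"
  proof -
    have "card {..<s+1} + card {..<s} \<le> core_count k s t"
      by (rule core_count_ge) (use that k st in \<open>auto intro: core_l_le core_r_le\<close>)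
    then show ?thesis by simp
  qed
  show "2 * s + 2 \<le> core_count k s t" if "3 \<le> s" "s \<le> k - 2" "s + 2 \<le> t \<or> t = k - 1" "s < t"
  proof -
    have "card {..<s+2} + card {..<s} \<le> core_count k s t"
      proof (rule core_count_ge)
      fix j assume "j \<in> {..<s+2}"
      then show "j < k \<and> core_l j \<le> s \<and> core_r k j \<le> t"
        using core_r_le_last[of j k] core_r_le[of j t k] core_l_le[of j s] that k by auto
    next
      fix j assume "j \<in> {..<s}"
      then show "j < k \<and> core_r k j \<le> s \<and> core_l j \<le> t"
        using core_r_le[of j s k] core_l_le[of j s] that k by auto
    qed
    then show ?thesis by simp
  qed
  show "2 \<le> core_count k s t" if "s = 2" "t = 2"
  proof -
    have "card {0::nat} + card {0::nat} \<le> core_count k s t"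
      by (rule core_count_ge) (use that k st in \<open>auto simp: core_small\<close>)
    then show ?thesis by simp
  qed
  show "4 \<le> core_count k s t" if "s = 2" "t = 3"
  proof -
    have "card {0::nat,1,2} + card {0::nat} \<le> core_count k s t"
      by (rule core_count_ge) (use that k st in \<open>auto simp: core_small\<close>)
    then show ?thesis by simp
  qed
  show "5 \<le> core_count k s t" if "s = 2" "t = 4"
  proof -
    have "card {0::nat,1,2,3} + card {0::nat} \<le> core_count k s t"
      by (rule core_count_ge) (use that k st in \<open>auto simp: core_small\<close>)
    then show ?thesis by simp
  qed
  show "6 \<le> core_count k s t" if "s = 2" "5 \<le> t"
  proof -
    have "card {0::nat,1,2,3,4} + card {0::nat} \<le> core_count k s t"
      by (rule core_count_ge) (use that k st in \<open>auto simp: core_small\<close>)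
    then show ?thesis by simp
  qed
  show "min (t - 1) 4 \<le> core_count k s t" if s: "s = 1"
  proof -
    consider "t = 1" | "t = 2" | "t = 3" | "t = 4" | "5 \<le> t" using s st by linarith
    then show ?thesis
    proof cases
      case 2
      have "card {0::nat} + card ({}::nat set) \<le> core_count k s t"
        by (rule core_count_ge[where B = "{}"]) (use 2 s k st in \<open>auto simp: core_small\<close>)
      then show ?thesis using 2 by simp
    next
      case 3
      have "card {0::nat,1} + card ({}::nat set) \<le> core_count k s t"
        by (rule core_count_ge[where B = "{}"]) (use 3 s k st in \<open>auto simp: core_small\<close>)
      then show ?thesis using 3 by simp
    next
      case 4
      have "card {0::nat,1,3} + card ({}::nat set) \<le> core_count k s t"
        by (rule core_count_ge[where B = "{}"]) (use 4 s k st in \<open>auto simp: core_small\<close>)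
      then show ?thesis using 4 by simp
    next
      case 5
      have "card {0::nat,1,3,4} + card ({}::nat set) \<le> core_count k s t"
        by (rule core_count_ge[where B = "{}"]) (use 5 s k st in \<open>auto simp: core_small\<close>)
      then show ?thesis using 5 by simp
    qed simp
  qed
qed

section \<open>Paths with one additional edge at each end\<close>

text \<open>
  The path \<open>v 1, \<dots>, v (k - 1)\<close> with the additional edges \<open>{u, v 1}\<close> and \<open>{v (k - 1), u'}\<close>. The edge
  with index \<open>i\<close> joins \<open>l i\<close> and \<open>r i\<close>, so that the values of \<open>l\<close> are the path vertices and \<open>u\<close>, those of \<open>r\<close> the
  path vertices and \<open>u'\<close>. The conditions on \<open>u\<close> and \<open>u'\<close> say that the \<open>k\<close> edges are distinct and no loops. Either of
  \<open>u\<close> and \<open>u'\<close> may lie on or off the path.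
\<close>

locale looped_path =
  fixes k :: nat and v :: "nat \<Rightarrow> 'a" and u u' :: 'a
  assumes k: "6 \<le> k" and inj: "inj_on v {1..<k}"
    and u: "u \<noteq> v 1" "u \<noteq> v 2" and u': "u' \<noteq> v (k - 1)" "u' \<noteq> v (k - 2)"
    and not_double: "\<not> (u = v (k - 1) \<and> u' = v 1)"
begin

definition l :: "nat \<Rightarrow> 'a" where "l i = (if i = 0 then u else v i)"
definition r :: "nat \<Rightarrow> 'a" where "r i = (if i = k - 1 then u' else v (Suc i))"

lemma v_eq_iff: "1 \<le> i \<Longrightarrow> i < k \<Longrightarrow> 1 \<le> j \<Longrightarrow> j < k \<Longrightarrow> v i = v j \<longleftrightarrow> i = j"
  using inj by (auto simp: inj_on_def)

lemma no_loop: "i < k \<Longrightarrow> l i \<noteq> r i"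
  using u(1) u'(1) k v_eq_iff[of i "Suc i"] by (auto simp: l_def r_def)

lemma edges_distinct: "inj_on (\<lambda>i. {l i, r i}) {..<k}"
proof (rule linorder_inj_onI')
  fix i j assume ij: "i \<in> {..<k}" "j \<in> {..<k}" "i < j"
  have v1: "v 1 \<noteq> v (k - 1)" using k by (simp add: v_eq_iff)
  consider "i = 0" "j = k - 1" | "i = 0" "j < k - 1" | "0 < i" "j = k - 1" | "0 < i" "j < k - 1"
    using ij by fastforce
  then show "{l i, r i} \<noteq> {l j, r j}"
  proof cases
    case 1
    then have "l i = u" "r i = v 1" "l j = v (k - 1)" "r j = u'" using k by (simp_all add: l_def r_def)
    then show ?thesis using v1 not_double by (auto simp: doubleton_eq_iff)
  next
    case 2
    then have eqs: "l i = u" "r i = v 1" "l j = v j" "r j = v (Suc j)"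
      using k ij by (simp_all add: l_def r_def)
    have "v 1 \<noteq> v (Suc j)" using 2 k ij by (simp add: v_eq_iff)
    moreover have "j = 1" if "v 1 = v j" using that ij k by (simp add: v_eq_iff)
    ultimately show ?thesis using eqs u by (auto simp: doubleton_eq_iff numeral_2_eq_2)
  next
    case 3
    then have eqs: "l i = v i" "r i = v (Suc i)" "l j = v (k - 1)" "r j = u'"
      using k ij by (simp_all add: l_def r_def)
    have "v i \<noteq> v (k - 1)" using 3 k ij by (simp add: v_eq_iff)
    moreover have "i = k - 2" if "v (Suc i) = v (k - 1)"
    proof -
      have "Suc i = k - 1" using that ij k 3 v_eq_iff[of "Suc i" "k - 1"] by simp
      then show ?thesis by simp
    qed
    ultimately show ?thesis using eqs u' by (auto simp: doubleton_eq_iff)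
  next
    case 4
    then have eqs: "l i = v i" "r i = v (Suc i)" "l j = v j" "r j = v (Suc j)"
      using k ij by (simp_all add: l_def r_def)
    have "v i \<noteq> v j" "v i \<noteq> v (Suc j)" using 4 k ij by (simp_all add: v_eq_iff)
    then show ?thesis using eqs by (auto simp: doubleton_eq_iff)
  qed
qed

text \<open>
  Each path vertex occurs exactly once among the \<open>l i\<close> with \<open>i > 0\<close> and once among the \<open>r i\<close> with
  \<open>i < k - 1\<close>; the two remaining ends are \<open>u\<close> and \<open>u'\<close>.
\<close>

lemma degree_sum_le:
  assumes "finite S"
  shows "card {i\<in>{..<k}. l i \<in> S} + card {i\<in>{..<k}. r i \<in> S} \<le>
    2 * card S + of_bool (u \<in> S) + of_bool (u' \<in> S)"
proof -
  have "card {i\<in>{1..<k}. v i \<in> S} = card (v ` {i\<in>{1..<k}. v i \<in> S})"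
    by (rule card_image[symmetric]) (rule inj_on_subset[OF inj], auto)
  also have "\<dots> \<le> card S" using assms by (intro card_mono) auto
  finally have path: "card {i\<in>{1..<k}. v i \<in> S} \<le> card S" .
  have "{i\<in>{..<k}. l i \<in> S} = (if u \<in> S then {0} else {}) \<union> {i\<in>{1..<k}. v i \<in> S}"
    using k by (auto simp: l_def split: if_splits)
  then have L: "card {i\<in>{..<k}. l i \<in> S} \<le> of_bool (u \<in> S) + card {i\<in>{1..<k}. v i \<in> S}"
    using card_Un_le[of "if u \<in> S then {0} else {}" "{i\<in>{1..<k}. v i \<in> S}"] by auto
  have "Suc ` {i\<in>{..<k}. r i \<in> S} \<subseteq> (if u' \<in> S then {k} else {}) \<union> {i\<in>{1..<k}. v i \<in> S}"
    using k by (auto simp: r_def split: if_splits)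
  then have "card (Suc ` {i\<in>{..<k}. r i \<in> S}) \<le>
      card ((if u' \<in> S then {k} else {}) \<union> {i\<in>{1..<k}. v i \<in> S})"
    by (intro card_mono) auto
  also have "\<dots> \<le> of_bool (u' \<in> S) + card {i\<in>{1..<k}. v i \<in> S}"
    using card_Un_le[of "if u' \<in> S then {k} else {}" "{i\<in>{1..<k}. v i \<in> S}"] by auto
  finally have "card {i\<in>{..<k}. r i \<in> S} \<le> of_bool (u' \<in> S) + card {i\<in>{1..<k}. v i \<in> S}"
    by (simp add: card_image)
  with L path show ?thesis by linarith
qed

text \<open>
  A set of at most \<open>k - 2\<close> vertices misses a path vertex \<open>v m\<close>. Orienting every edge towards this
  gap, to its right end below \<open>m\<close> and to its left end from \<open>m\<close> on, assigns distinct vertices of the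
  set to the edges inside it, the two additional edges included.
\<close>

lemma induced_edges_le:
  assumes S: "finite S" "card S \<le> k - 2"
  shows "card {i\<in>{..<k}. l i \<in> S \<and> r i \<in> S} \<le> card S"
proof -
  have "\<not> v ` {1..<k} \<subseteq> S"
    using card_mono[OF S(1), of "v ` {1..<k}"] card_image[OF inj] S(2) k by auto
  then obtain m where m: "1 \<le> m" "m < k" "v m \<notin> S"
    by (metis atLeastLessThan_iff image_subsetI)
  define \<tau> where "\<tau> i = (if i < m then Suc i else i)" for i
  let ?I = "{i\<in>{..<k}. l i \<in> S \<and> r i \<in> S}"
  have \<tau>: "1 \<le> \<tau> i \<and> \<tau> i < k \<and> \<tau> i \<noteq> m \<and> v (\<tau> i) \<in> S" if "i \<in> ?I" for i
  proof (cases "i < m")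
    case True
    then have "r i = v (Suc i)" using m by (auto simp: r_def)
    then show ?thesis using True m that by (auto simp: \<tau>_def)
  next
    case False
    then have "l i = v i" using m by (auto simp: l_def)
    then show ?thesis using False m that by (auto simp: \<tau>_def)
  qed
  have "inj_on (\<lambda>i. v (\<tau> i)) ?I"
  proof (rule inj_onI)
    fix i j assume ij: "i \<in> ?I" "j \<in> ?I" "v (\<tau> i) = v (\<tau> j)"
    then have "\<tau> i = \<tau> j" using \<tau>[of i] \<tau>[of j] v_eq_iff by blast
    then show "i = j" using \<tau>[of i] \<tau>[of j] ij by (auto simp: \<tau>_def split: if_splits)
  qed
  then have "card ?I = card ((\<lambda>i. v (\<tau> i)) ` ?I)" by (simp add: card_image)
  also have "\<dots> \<le> card S" using \<tau> S by (intro card_mono) auto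
  finally show ?thesis .
qed

definition arcs :: "'a set \<Rightarrow> 'a set \<Rightarrow> nat" where
  "arcs S T = card {i\<in>{..<k}. l i \<in> S \<and> r i \<in> T} + card {i\<in>{..<k}. r i \<in> S \<and> l i \<in> T}"

lemma arcs_le_total: "arcs S T \<le> 2 * k"
proof -
  have "arcs S T \<le> card {..<k} + card {..<k}"
    unfolding arcs_def by (intro add_mono card_mono) auto
  then show ?thesis by simp
qed

lemma arcs_le_degrees:
  assumes "finite S"
  shows "arcs S T \<le> 2 * card S + 2"
proof -
  have "arcs S T \<le> card {i\<in>{..<k}. l i \<in> S} + card {i\<in>{..<k}. r i \<in> S}"
    unfolding arcs_def by (intro add_mono card_mono) auto
  with degree_sum_le[OF assms] show ?thesis
    by (cases "u \<in> S"; cases "u' \<in> S") auto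
qed

text \<open>
  An edge inside \<open>T\<close> that meets \<open>S\<close> contributes one arc, and a second one only if it lies inside \<open>S\<close>.
\<close>

lemma arcs_le_induced:
  assumes "S \<subseteq> T"
  shows "arcs S T \<le> card {i\<in>{..<k}. l i \<in> S \<and> r i \<in> S} + card {i\<in>{..<k}. l i \<in> T \<and> r i \<in> T}"
proof -
  let ?A = "{i\<in>{..<k}. l i \<in> S \<and> r i \<in> T}" and ?B = "{i\<in>{..<k}. r i \<in> S \<and> l i \<in> T}"
  have "arcs S T = card (?A \<union> ?B) + card (?A \<inter> ?B)"
    unfolding arcs_def by (rule card_Un_Int) auto
  moreover have "card (?A \<union> ?B) \<le> card {i\<in>{..<k}. l i \<in> T \<and> r i \<in> T}"
    using assms by (intro card_mono) auto
  moreover have "card (?A \<inter> ?B) \<le> card {i\<in>{..<k}. l i \<in> S \<and> r i \<in> S}"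
    by (intro card_mono) auto
  ultimately show ?thesis by simp
qed

lemma arcs_le_complete:
  assumes ST: "S \<subseteq> T" and T: "finite T"
  shows "arcs S T \<le> card S * (card T - 1)"
proof -
  let ?A = "{i\<in>{..<k}. l i \<in> S \<and> r i \<in> T}" and ?B = "{i\<in>{..<k}. r i \<in> S \<and> l i \<in> T}"
  let ?P = "SIGMA y:S. T - {y}"
  have fS: "finite S" using ST T by (rule finite_subset)
  have same: "i = j" if "i < k" "j < k" "{l i, r i} = {l j, r j}" for i j
    using edges_distinct that by (auto simp: inj_on_def)
  have disj: "(\<lambda>i. (l i, r i)) ` ?A \<inter> (\<lambda>i. (r i, l i)) ` ?B = {}"
  proof -
    have False if "i < k" "j < k" "l i = r j" "r i = l j" for i j
      using same[of i j] no_loop[of i] that by auto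
    then show ?thesis by auto
  qed
  have "arcs S T = card ((\<lambda>i. (l i, r i)) ` ?A) + card ((\<lambda>i. (r i, l i)) ` ?B)"
    unfolding arcs_def using same
    by (intro arg_cong2[where f = "(+)"] card_image[symmetric] inj_onI) auto
  also have "\<dots> = card ((\<lambda>i. (l i, r i)) ` ?A \<union> (\<lambda>i. (r i, l i)) ` ?B)"
    using disj by (subst card_Un_disjoint) auto
  also have "\<dots> \<le> card ?P"
    using no_loop fS T by (intro card_mono finite_SigmaI) (auto dest: sym)
  also have "\<dots> = (\<Sum>y\<in>S. card (T - {y}))" using fS T by (intro card_SigmaI) auto
  also have "\<dots> = card S * (card T - 1)"
    using ST T by (simp add: subset_iff)
  finally show ?thesis .
qed

text \<open>
  The table behind the optimality of \<open>\<Delta>\<^sub>2\<close>: each entry of \<open>core_count_lower\<close> is matched by one of the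
  upper bounds by simplicity, by induced edges or by degrees.
\<close>

lemma arcs_le_core_count:
  assumes ST: "S \<subseteq> T" "finite T" and s: "card S \<le> s" and t: "card T \<le> t" and st: "s \<le> t"
  shows "arcs S T \<le> core_count k s t"
proof -
  note lower = core_count_lower[OF k st]
  have fS: "finite S" using ST by (rule finite_subset)
  have deg: "arcs S T \<le> 2 * s + 2" using arcs_le_degrees[OF fS, of T] s by simp
  have complete: "arcs S T \<le> s * (t - 1)"
    using arcs_le_complete[OF ST] mult_le_mono[OF s diff_le_mono[OF t, of 1]] by simp
  have iS: "card {i\<in>{..<k}. l i \<in> S \<and> r i \<in> S} \<le> s" if "s \<le> k - 2"
    using induced_edges_le[OF fS] s that by simp
  have iT: "card {i\<in>{..<k}. l i \<in> T \<and> r i \<in> T} \<le> t" if "t \<le> k - 2"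
    using induced_edges_le[OF ST(2)] t that by simp
  consider "s = 0" | "s = 1" | "s = 2" | "3 \<le> s" "s \<le> k - 2" | "k - 1 \<le> s"
    using k by fastforce
  then show ?thesis
  proof cases
    case 1 then show ?thesis using complete by simp
  next
    case 2 then show ?thesis using complete deg lower(9) by simp
  next
    case 3
    consider "t = 2 \<or> t = 3" | "t = 4" | "5 \<le> t" using st 3 by fastforce
    then show ?thesis
    proof cases
      case 1 then show ?thesis using 3 complete lower(5,6) by auto
    next
      case 2
      have "2 * card {i\<in>{..<k}. l i \<in> S \<and> r i \<in> S} = arcs S S" by (simp add: arcs_def conj_commute)
      also have "\<dots> \<le> card S * (card S - 1)" using fS by (intro arcs_le_complete) auto
      also have "\<dots> \<le> 2 * 1" using s 3 by (intro mult_le_mono) auto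
      finally show ?thesis using arcs_le_induced[OF ST(1)] iT 2 3 k lower(7) by (simp; linarith)
    next
      case 3 then show ?thesis using \<open>s = 2\<close> deg lower(8) by simp
    qed
  next
    case 4
    consider "t = s" | "s \<le> k - 3" "t = s + 1" | "s + 2 \<le> t \<or> t = k - 1" "s < t"
      using st 4 by fastforce
    then show ?thesis
    proof cases
      case 1 then show ?thesis using arcs_le_induced[OF ST(1)] iS iT lower(2) 4 by simp
    next
      case 2 then show ?thesis using arcs_le_induced[OF ST(1)] iS iT lower(3) k 4 by (simp; linarith)
    next
      case 3 then show ?thesis using deg lower(4) 4 by simp
    qed
  next
    case 5 then show ?thesis using arcs_le_total[of S T] lower(1) by simp
  qed
qed

text \<open>
  The sorted \<open>\<Delta>\<^sub>2\<close> has the largest edge sum for every decreasing weighting. The ranking \<open>\<rho>\<close> starts at 1,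
  so at most \<open>n\<close> vertices have rank at most \<open>n\<close>.
\<close>

lemma edge_sum_le_core:
  fixes a :: "nat \<Rightarrow> real"
  assumes a: "decseq a" "\<And>n. 0 \<le> a n"
    and \<rho>: "inj_on \<rho> (l ` {..<k} \<union> r ` {..<k})" "\<And>z. z \<in> l ` {..<k} \<union> r ` {..<k} \<Longrightarrow> 1 \<le> \<rho> z"
  shows "(\<Sum>i<k. a (\<rho> (l i)) * a (\<rho> (r i))) \<le> (\<Sum>j<k. a (core_l j) * a (core_r k j))"
proof (rule sum_products_dominated[OF _ _ a])
  fix s t :: nat assume st: "s \<le> t"
  define X where "X = l ` {..<k} \<union> r ` {..<k}"
  define S where "S n = {z\<in>X. \<rho> z \<le> n}" for n
  have fin: "finite (S n)" for n by (simp add: S_def X_def)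
  have card: "card (S n) \<le> n" for n
  proof -
    have "card (\<rho> ` S n) = card (S n)"
      using \<rho>(1) by (intro card_image inj_on_subset[OF \<rho>(1)]) (auto simp: S_def X_def)
    moreover have "card (\<rho> ` S n) \<le> card {1..n}"
      using \<rho>(2) by (intro card_mono) (auto simp: S_def X_def)
    ultimately show ?thesis by simp
  qed
  have "arcs (S s) (S t) \<le> core_count k s t"
    using fin card st by (intro arcs_le_core_count) (auto simp: S_def)
  moreover have "arcs (S s) (S t) = card {i \<in> {..<k}. \<rho> (l i) \<le> s \<and> \<rho> (r i) \<le> t} +
      card {i \<in> {..<k}. \<rho> (r i) \<le> s \<and> \<rho> (l i) \<le> t}"
    unfolding arcs_def
    by (intro arg_cong2[where f = "(+)"] arg_cong[where f = card]) (auto simp: S_def X_def)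
  ultimately show "card {i \<in> {..<k}. \<rho> (l i) \<le> s \<and> \<rho> (r i) \<le> t} +
      card {i \<in> {..<k}. \<rho> (r i) \<le> s \<and> \<rho> (l i) \<le> t} \<le>
      card {j \<in> {..<k}. core_l j \<le> s \<and> core_r k j \<le> t} +
      card {j \<in> {..<k}. core_r k j \<le> s \<and> core_l j \<le> t}"
    by (simp add: core_count_def)
qed auto

end

section \<open>The extremal hypergraph\<close>

text \<open>
  The suspension of the sorted \<open>\<Delta>\<^sub>2\<close>, placed on the vertices enumerated by \<open>h\<close>.
\<close>

definition core_hypergraph :: "nat \<Rightarrow> (nat \<Rightarrow> 'a) \<Rightarrow> 'a hypergraph" where
  "core_hypergraph k h = (h ` {..<k}, (\<lambda>j. {h 0, h (core_l j), h (core_r k j)}) ` {..<k})"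

lemma core_ends:
  assumes "6 \<le> k" "j < k"
  shows "1 \<le> core_l j" "core_l j < core_r k j" "core_r k j < k"
proof -
  show "1 \<le> core_l j" by (auto simp: core_l_def)
  show "core_l j < core_r k j"
    using assms unfolding core_l_def core_r_def by (auto split: if_splits)
  show "core_r k j < k" using core_r_le_last[of j k] assms by linarith
qed

text \<open>
  The index of an edge can be read off from its ends; the inverse is given explicitly.
\<close>

lemma core_end_pairs_distinct:
  assumes k: "6 \<le> k"
  shows "inj_on (\<lambda>j. (core_l j, core_r k j)) {..<k}"
proof (rule inj_on_inverseI[where g = "\<lambda>(a, b). if a = 1 then (if b \<le> 3 then b - 2 else b - 1)
    else if a = 2 then 2 else a + 1"])
  fix j :: nat
  consider "j = 0" | "j = 1" | "j = 2" | "j = 3" | "j = 4" | "5 \<le> j" by linarith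
  then show "(case (core_l j, core_r k j) of (a, b) \<Rightarrow>
      if a = 1 then (if b \<le> 3 then b - 2 else b - 1) else if a = 2 then 2 else a + 1) = j"
  proof cases
    case 6
    then have "core_l j = j - 1" by (simp add: core_l_def)
    moreover have "j - 1 \<noteq> 1" "j - 1 \<noteq> 2" "j - 1 + 1 = j" using 6 by linarith+
    ultimately show ?thesis by simp
  qed (use k in \<open>simp_all add: core_small\<close>)
qed

lemma core_edges_distinct:
  assumes k: "6 \<le> k"
  shows "inj_on (\<lambda>j. {core_l j, core_r k j}) {..<k}"
proof (rule linorder_inj_onI')
  fix i j assume ij: "i \<in> {..<k}" "j \<in> {..<k}" "i < j"
  have "core_l i \<noteq> core_l j \<or> core_r k i \<noteq> core_r k j"
    using ij inj_onD[OF core_end_pairs_distinct[OF k], of i j] by auto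
  then show "{core_l i, core_r k i} \<noteq> {core_l j, core_r k j}"
    using core_ends(2)[OF k, of i] core_ends(2)[OF k, of j] ij by (auto simp: doubleton_eq_iff)
qed

context
  fixes k :: nat and h :: "nat \<Rightarrow> 'a"
  assumes k: "6 \<le> k" and h: "inj_on h {..<k}"
begin

lemma core_eq_iff: "i < k \<Longrightarrow> j < k \<Longrightarrow> h i = h j \<longleftrightarrow> i = j"
  using h by (auto simp: inj_on_def)

lemma core_hypergraph_edges_distinct:
  "inj_on (\<lambda>j. {h 0, h (core_l j), h (core_r k j)}) {..<k}"
proof (rule inj_onI)
  fix i j assume ij: "i \<in> {..<k}" "j \<in> {..<k}"
    and eq: "{h 0, h (core_l i), h (core_r k i)} = {h 0, h (core_l j), h (core_r k j)}"
  note ends = core_ends[OF k, of i] core_ends[OF k, of j]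
  have "h ` {0, core_l i, core_r k i} = h ` {0, core_l j, core_r k j}" using eq by simp
  then have "{0, core_l i, core_r k i} = {0, core_l j, core_r k j}"
    using ij ends by (subst (asm) inj_on_image_eq_iff[OF h]) auto
  then have "{0, core_l i, core_r k i} - {0} = {0, core_l j, core_r k j} - {0}" by simp
  then have "{core_l i, core_r k i} = {core_l j, core_r k j}" using ij ends by auto
  then show "i = j" using core_edges_distinct[OF k] ij by (auto simp: inj_on_def)
qed

lemma core_hypergraph_uniform: "uniform_hypergraph 3 (core_hypergraph k h)"
proof -
  have "card {h 0, h (core_l j), h (core_r k j)} = 3" if "j < k" for j
    using core_ends[OF k that] k by (simp add: core_eq_iff)
  moreover have "{h 0, h (core_l j), h (core_r k j)} \<subseteq> h ` {..<k}" if "j < k" for j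
    using core_ends[OF k that] k by auto
  ultimately show ?thesis by (auto simp: uniform_hypergraph_def core_hypergraph_def)
qed

lemma core_hypergraph_edge_sum:
  "(\<Sum>e\<in>edges (core_hypergraph k h). \<Prod>i\<in>e. x i :: real) =
    x (h 0) * (\<Sum>j<k. x (h (core_l j)) * x (h (core_r k j)))"
proof -
  have "(\<Prod>i\<in>{h 0, h (core_l j), h (core_r k j)}. x i) = x (h 0) * (x (h (core_l j)) * x (h (core_r k j)))"
    if "j < k" for j
    using core_ends[OF k that] k by (simp add: core_eq_iff)
  then show ?thesis
    using core_hypergraph_edges_distinct
    by (simp add: core_hypergraph_def sum.reindex sum_distrib_left)
qed

end

text \<open>
  Both cycles of \<open>\<Delta>\<^sub>2\<close> in one closed walk \<open>0, 1, 2, 0, 3, 4, \<dots>, k - 2, 0\<close> of length \<open>k\<close>, which visits the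
  shared vertex 0 at the times 0, 3 and \<open>k\<close>.
\<close>

lemma Delta2_edges:
  assumes k: "6 \<le> k"
  defines "c \<equiv> \<lambda>i. if i = 0 \<or> i = k \<or> i = 3 then 0 else if i \<le> 2 then i else i - 1"
  shows "verts (Delta2 k) = {..<k-1}" "edges (Delta2 k) = (\<lambda>i. {c i, c (Suc i)}) ` {..<k}"
proof -
  let ?vs = "0 # [3..<k - 1]"
  have len: "length ?vs = k - 3" using k by simp
  show "verts (Delta2 k) = {..<k-1}"
    using k by (auto simp: Delta2_def cycle_through_def Let_def)
  have nth: "?vs ! i = (if i = 0 then 0 else i + 2)" if "i < k - 3" for i
    using that k by (cases i) auto
  have "edges (cycle_through ?vs) = {{?vs ! i, ?vs ! (Suc i mod (k - 3))} | i. i < k - 3}"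
    unfolding cycle_through_def len by simp
  also have "\<dots> = (\<lambda>i. {?vs ! i, ?vs ! (Suc i mod (k - 3))}) ` {..<k-3}" by auto
  also have "\<dots> = (\<lambda>i. {c (i + 3), c (Suc (i + 3))}) ` {..<k-3}"
  proof (rule image_cong)
    fix i assume i: "i \<in> {..<k-3}"
    have "?vs ! i = c (i + 3)" using i k nth[of i] by (auto simp: c_def)
    moreover have "?vs ! (Suc i mod (k - 3)) = c (Suc (i + 3))"
    proof (cases "Suc i = k - 3")
      case True
      then have "Suc (i + 3) = k" using k by linarith
      then show ?thesis using True by (simp add: c_def)
    next
      case False
      then show ?thesis using i k nth[of "Suc i"] by (auto simp: c_def)
    qed
    ultimately show "{?vs ! i, ?vs ! (Suc i mod (k - 3))} = {c (i + 3), c (Suc (i + 3))}" by simp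
  qed simp
  also have "\<dots> = (\<lambda>i. {c i, c (Suc i)}) ` ((\<lambda>i. i + 3) ` {..<k-3})" by (simp add: image_image)
  also have "(\<lambda>i. i + 3) ` {..<k-3} = {3..<k}"
    using k image_add_atLeastLessThan'[of 3 0 "k - 3"] by (simp add: atLeast0LessThan)
  finally have C: "edges (cycle_through ?vs) = (\<lambda>i. {c i, c (Suc i)}) ` {3..<k}" .
  have "edges (cycle_through [0, 1, 2::nat]) = (\<lambda>i. {c i, c (Suc i)}) ` {0, 1, 2}"
  proof -
    have "{..<3} = {0, 1, 2::nat}" by auto
    moreover have "edges (cycle_through [0, 1, 2::nat]) =
        (\<lambda>i. {[0, 1, 2] ! i, [0, 1, 2] ! (Suc i mod 3)}) ` {..<3}"
      by (auto simp: cycle_through_def)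
    ultimately show ?thesis using k by (simp add: c_def insert_commute numeral_2_eq_2)
  qed
  moreover have "{..<k} = {0, 1, 2} \<union> {3..<k}" using k by auto
  ultimately show "edges (Delta2 k) = (\<lambda>i. {c i, c (Suc i)}) ` {..<k}"
    unfolding Delta2_def Let_def snd_conv using C by (simp only: image_Un)
qed

text \<open>
  A criterion for being the suspended \<open>\<Delta>\<^sub>2\<close> in terms of the closed walk of \<open>Delta2_edges\<close>; it serves for
  the sorted copy and for the extremal \<open>H\<close>. Time 3 is the second visit to the shared vertex, hence
  \<open>q 3\<close> also stands for the times 0 and \<open>k\<close>.
\<close>

lemma iso_suspension_Delta2:
  assumes k: "6 \<le> k" and q: "inj_on q {1..<k}" and w: "w \<notin> q ` {1..<k}"
    and V: "verts H = insert w (q ` {1..<k})"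
    and E: "edges H = (\<lambda>i. {w, g i, g (Suc i)}) ` {..<k}"
    and g: "\<And>i. i \<le> k \<Longrightarrow> g i = (if i = 0 \<or> i = k then q 3 else q i)"
  shows "H \<simeq>\<^sub>H suspension (Delta2 k)"
proof -
  define c where "c i = (if i = 0 \<or> i = k \<or> i = 3 then 0 else if i \<le> 2 then i else i - 1)" for i
  note D = Delta2_edges[OF k, folded c_def]
  define f where "f z = (if z = w then None else Some (c (the_inv_into {1..<k} q z)))" for z
  have fw: "f w = None" by (simp add: f_def)
  have fq: "f (q i) = Some (c i)" if "i \<in> {1..<k}" for i
    using that w the_inv_into_f_f[OF q that] by (auto simp: f_def)
  have fg: "f (g i) = Some (c i)" if "i \<le> k" for i
    using that k fq[of 3] fq[of i] by (auto simp: g c_def)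
  have inj_c: "inj_on c {1..<k}"
    by (rule inj_on_inverseI[where g = "\<lambda>n. if n = 0 then 3 else if n \<le> 2 then n else n + 1"])
       (auto simp: c_def)
  have "c ` {1..<k} \<subseteq> {..<k-1}" using k by (auto simp: c_def)
  moreover have "card (c ` {1..<k}) = card {..<k-1}" using card_image[OF inj_c] by simp
  ultimately have cimg: "c ` {1..<k} = {..<k-1}" by (intro card_subset_eq) simp_all
  have "bij_betw f (verts H) (verts (suspension (Delta2 k)))"
  proof (rule bij_betw_imageI)
    show "inj_on f (verts H)"
      unfolding V
    proof (rule inj_onI)
      fix y z assume yz: "y \<in> insert w (q ` {1..<k})" "z \<in> insert w (q ` {1..<k})" "f y = f z"
      then show "y = z"
        using fw fq inj_onD[OF inj_c] by (elim insertE imageE) (simp_all, metis)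
    qed
    have "f ` q ` {1..<k} = Some ` c ` {1..<k}"
      unfolding image_image using fq by (intro image_cong) auto
    then show "f ` verts H = verts (suspension (Delta2 k))"
      by (simp only: V image_insert fw suspension_def fst_conv D(1) cimg)
  qed
  moreover have "edges (suspension (Delta2 k)) = (\<lambda>e. f ` e) ` edges H"
    unfolding suspension_def snd_conv D(2) E image_image
  proof (rule image_cong)
    fix i assume "i \<in> {..<k}"
    then show "insert None (Some ` {c i, c (Suc i)}) = f ` {w, g i, g (Suc i)}"
      using fg[of i] fg[of "Suc i"] fw by simp
  qed simp
  ultimately show ?thesis unfolding hypergraph_iso_def by blast
qed

text \<open>
  The ranks met by the closed walk through the sorted \<open>\<Delta>\<^sub>2\<close>: the triangle \<open>1, 2, 3, 1\<close>, then up the even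
  ranks from 4 and down the odd ranks to 5.
\<close>

definition zigzag :: "nat \<Rightarrow> nat \<Rightarrow> nat" where
  "zigzag k i = (if i = 0 \<or> i = k \<or> i = 3 then 1 else if i \<le> 2 then i + 1
     else if 2 * (i - 4) < k - 4 then 4 + 2 * (i - 4) else 5 + 2 * (k - 1 - i))"

text \<open>
  Apart from the first five edges, an edge of even lower rank is traversed on the way up, one of odd
  lower rank on the way down, and the last edge at the turning point, whose direction depends on the
  parity of \<open>k\<close>.
\<close>

lemma core_edge_in_zigzag:
  assumes k: "6 \<le> k" and j: "j < k"
  shows "\<exists>i<k. {core_l j, core_r k j} = {zigzag k i, zigzag k (Suc i)}"
proof -
  consider "j = 0" | "j = 1" | "j = 2" | "j = 3" | "j = 4" | "5 \<le> j" by linarith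
  then show ?thesis
  proof cases
    case 1
    then show ?thesis using k by (intro exI[of _ 0]) (auto simp: core_l_def core_r_def zigzag_def)
  next
    case 2
    then show ?thesis using k by (intro exI[of _ 2]) (auto simp: core_l_def core_r_def zigzag_def)
  next
    case 3
    then show ?thesis using k by (intro exI[of _ 1]) (auto simp: core_l_def core_r_def zigzag_def)
  next
    case 4
    then show ?thesis using k by (intro exI[of _ 3]) (auto simp: core_l_def core_r_def zigzag_def)
  next
    case 5
    have "zigzag k (k - 1) = 5" "zigzag k k = 1" using k by (auto simp: zigzag_def)
    then show ?thesis using 5 k core_small by (intro exI[of _ "k - 1"]) auto
  next
    case 6
    show ?thesis
    proof (cases "j < k - 1")
      case jk: True
      show ?thesis
      proof (cases "even (j - 1)")
        case True
        then obtain m where "j - 1 = 2 * m" by (metis evenE)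
        then obtain p where p: "j = 5 + 2 * p" using 6 by (intro that[of "m - 2"]) linarith
        have "zigzag k (4 + p) = 4 + 2 * p" "zigzag k (5 + p) = 6 + 2 * p"
          using jk p by (auto simp: zigzag_def)
        then show ?thesis using jk p by (intro exI[of _ "4 + p"]) (auto simp: core_l_def core_r_def)
      next
        case False
        then obtain m where "j - 1 = 2 * m + 1" by (metis oddE)
        then obtain p where p: "j = 6 + 2 * p" using 6 by (intro that[of "m - 2"]) linarith
        have "zigzag k (k - 2 - p) = 7 + 2 * p" "zigzag k (Suc (k - 2 - p)) = 5 + 2 * p"
          using jk p by (auto simp: zigzag_def)
        then show ?thesis using jk p by (intro exI[of _ "k - 2 - p"]) (auto simp: core_l_def core_r_def)
      qed
    next
      case False
      then have jk: "j = k - 1" using j by linarith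
      show ?thesis
      proof (cases "even (k - 5)")
        case True
        then obtain m where "k - 5 = 2 * m" by (metis evenE)
        then obtain p where p: "k = 5 + 2 * p" using k by (intro that[of m]) linarith
        have "zigzag k (4 + p) = k - 1" "zigzag k (Suc (4 + p)) = k - 2"
          using p k by (auto simp: zigzag_def)
        then show ?thesis using jk p k by (intro exI[of _ "4 + p"]) (auto simp: core_l_def core_r_def)
      next
        case False
        then obtain m where "k - 5 = 2 * m + 1" by (metis oddE)
        then obtain p where p: "k = 6 + 2 * p" using k by (intro that[of m]) linarith
        have "zigzag k (4 + p) = k - 2" "zigzag k (Suc (4 + p)) = k - 1"
          using p k by (auto simp: zigzag_def)
        then show ?thesis using jk p k by (intro exI[of _ "4 + p"]) (auto simp: core_l_def core_r_def)
      qed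
    qed
  qed
qed

text \<open>
  One inclusion is \<open>core_edge_in_zigzag\<close>; equality holds because the walk has only \<open>k\<close> steps.
\<close>

lemma zigzag_edges:
  assumes k: "6 \<le> k"
  shows "(\<lambda>i. {zigzag k i, zigzag k (Suc i)}) ` {..<k} = (\<lambda>j. {core_l j, core_r k j}) ` {..<k}"
proof (rule card_seteq[symmetric])
  show "(\<lambda>j. {core_l j, core_r k j}) ` {..<k} \<subseteq> (\<lambda>i. {zigzag k i, zigzag k (Suc i)}) ` {..<k}"
    using core_edge_in_zigzag[OF k] by fastforce
  have "card ((\<lambda>i. {zigzag k i, zigzag k (Suc i)}) ` {..<k}) \<le> k"
    using card_image_le[of "{..<k}"] by simp
  then show "card ((\<lambda>i. {zigzag k i, zigzag k (Suc i)}) ` {..<k}) \<le>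
      card ((\<lambda>j. {core_l j, core_r k j}) ` {..<k})"
    using core_edges_distinct[OF k] by (simp add: card_image)
qed simp

text \<open>
  The core edges cover all ranks, so the walk visits \<open>k - 1\<close> ranks at \<open>k - 1\<close> times.
\<close>

lemma zigzag_bij:
  assumes k: "6 \<le> k"
  shows "inj_on (zigzag k) {1..<k}" "zigzag k ` {1..<k} = {1..<k}"
proof -
  have "{1..<k} \<subseteq> (\<Union>j<k. {core_l j, core_r k j})"
  proof
    fix m assume m: "m \<in> {1..<k}"
    show "m \<in> (\<Union>j<k. {core_l j, core_r k j})"
    proof (cases "m = 1")
      case True
      then have "m = core_l 0" by (simp add: core_small)
      then show ?thesis using k by auto
    next
      case False
      then have "m = core_r k (if m \<le> 3 then m - 2 else m - 1)"
        using m k by (auto simp: core_r_def)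
      moreover have "(if m \<le> 3 then m - 2 else m - 1) < k" using m by auto
      ultimately show ?thesis by blast
    qed
  qed
  also have "\<dots> = \<Union> ((\<lambda>i. {zigzag k i, zigzag k (Suc i)}) ` {..<k})"
    by (simp only: zigzag_edges[OF k])
  also have "\<dots> \<subseteq> zigzag k ` {1..<k}"
  proof -
    have "zigzag k i \<in> zigzag k ` {1..<k}" if "i \<le> k" for i
    proof (cases "i = 0 \<or> i = k")
      case True
      then have "zigzag k i = zigzag k 3" by (auto simp: zigzag_def)
      then show ?thesis using k by auto
    qed (use that in auto)
    then show ?thesis by auto
  qed
  finally have sup: "{1..<k} \<subseteq> zigzag k ` {1..<k}" .
  have "card (zigzag k ` {1..<k}) \<le> card {1..<k}" by (rule card_image_le) simp
  with sup show img: "zigzag k ` {1..<k} = {1..<k}" by (metis card_seteq finite_atLeastLessThan finite_imageI)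
  then show "inj_on (zigzag k) {1..<k}" by (intro eq_card_imp_inj_on) auto
qed

lemma core_hypergraph_iso:
  assumes k: "6 \<le> k" and h: "inj_on h {..<k}"
  shows "core_hypergraph k h \<simeq>\<^sub>H suspension (Delta2 k)"
proof (rule iso_suspension_Delta2[OF k, where q = "h \<circ> zigzag k" and w = "h 0" and g = "h \<circ> zigzag k"])
  note z = zigzag_bij[OF k]
  show "inj_on (h \<circ> zigzag k) {1..<k}"
    using z h by (intro comp_inj_on) (auto intro: inj_on_subset)
  show "h 0 \<notin> (h \<circ> zigzag k) ` {1..<k}"
    unfolding image_comp[symmetric] z(2) using k by (auto dest!: inj_onD[OF h])
  have "{..<k} = insert 0 {1..<k}" using k by auto
  then show "verts (core_hypergraph k h) = insert (h 0) ((h \<circ> zigzag k) ` {1..<k})"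
    unfolding image_comp[symmetric] z(2) by (simp add: core_hypergraph_def)
  have "edges (core_hypergraph k h) = (\<lambda>f. insert (h 0) (h ` f)) ` (\<lambda>j. {core_l j, core_r k j}) ` {..<k}"
    by (simp add: core_hypergraph_def image_image)
  also have "\<dots> = (\<lambda>i. {h 0, (h \<circ> zigzag k) i, (h \<circ> zigzag k) (Suc i)}) ` {..<k}"
    unfolding zigzag_edges[OF k, symmetric] by (simp add: image_image)
  finally show "edges (core_hypergraph k h) = \<dots>" .
  show "(h \<circ> zigzag k) i = (if i = 0 \<or> i = k then (h \<circ> zigzag k) 3 else (h \<circ> zigzag k) i)" for i :: nat
    by (simp add: zigzag_def)
qed

section \<open>Reducing Berge cycles to paths\<close>

lemma decreasing_enumeration:
  fixes x :: "'a \<Rightarrow> real"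
  assumes "finite V"
  obtains h where "bij_betw h {..<card V} V"
    "\<And>i j. i \<le> j \<Longrightarrow> j < card V \<Longrightarrow> x (h j) \<le> x (h i)"
proof -
  obtain xs where xs: "distinct xs" "set xs = V" using assms finite_distinct_list by blast
  define ys where "ys = sort_key (\<lambda>z. - x z) xs"
  have ys: "distinct ys" "set ys = V" "length ys = card V"
    using xs distinct_card[of xs] by (auto simp: ys_def)
  have "bij_betw (\<lambda>i. ys ! i) {..<card V} V"
    using ys by (auto intro: bij_betw_nth)
  moreover have "x (ys ! j) \<le> x (ys ! i)" if "i \<le> j" "j < card V" for i j
  proof -
    have "sorted (map (\<lambda>z. - x z) ys)" by (simp add: ys_def)
    from sorted_nth_mono[OF this that(1)] show ?thesis using that ys(3) by simp
  qed
  ultimately show ?thesis by (rule that[of "\<lambda>i. ys ! i"])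
qed

text \<open>
  The edges of a Berge cycle indexed along the cycle, started at a prescribed vertex \<open>w\<close> if the cycle
  passes through it.
\<close>

lemma Berge_cycle_edges:
  assumes k: "3 \<le> k" and B: "is_Berge (cycle_graph k) H"
  obtains v E where "inj_on v {..<k}" "v ` {..<k} \<subseteq> verts H" "bij_betw E {..<k} (edges H)"
    "\<And>i. i < k \<Longrightarrow> {v i, v (Suc i mod k)} \<subseteq> E i" "v 0 = w \<or> w \<notin> v ` {..<k}"
proof -
  from B obtain f \<phi> where B': "inj_on f (verts (cycle_graph k)) \<and> f ` verts (cycle_graph k) \<subseteq> verts H \<and>
      bij_betw \<phi> (edges (cycle_graph k)) (edges H) \<and> (\<forall>e\<in>edges (cycle_graph k). f ` e \<subseteq> \<phi> e)"
    unfolding is_Berge_def by (elim exE)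
  then have f: "inj_on f (verts (cycle_graph k))" "f ` verts (cycle_graph k) \<subseteq> verts H"
    and \<phi>: "bij_betw \<phi> (edges (cycle_graph k)) (edges H)"
    and sub: "\<And>e. e \<in> edges (cycle_graph k) \<Longrightarrow> f ` e \<subseteq> \<phi> e"
    by simp_all
  let ?e = "\<lambda>i. {i, Suc i mod k}"
  have V: "verts (cycle_graph k) = {..<k}"
    by (auto simp: cycle_graph_def cycle_through_def)
  have E: "edges (cycle_graph k) = ?e ` {..<k}"
  proof -
    have "edges (cycle_graph k) = {{[0..<k] ! i, [0..<k] ! (Suc i mod k)} | i. i < k}"
      by (simp add: cycle_graph_def cycle_through_def)
    also have "\<dots> = (\<lambda>i. {[0..<k] ! i, [0..<k] ! (Suc i mod k)}) ` {..<k}" by blast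
    also have "\<dots> = ?e ` {..<k}" using k by (intro image_cong) simp_all
    finally show ?thesis .
  qed
  have "inj_on ?e {..<k}"
  proof (rule linorder_inj_onI')
    fix i j assume ij: "i \<in> {..<k}" "j \<in> {..<k}" "i < j"
    then have "Suc i mod k = Suc i" by auto
    moreover have "Suc j mod k = (if Suc j = k then 0 else Suc j)" using ij by auto
    ultimately show "?e i \<noteq> ?e j" using ij k by (auto simp: doubleton_eq_iff)
  qed
  then have e: "bij_betw ?e {..<k} (edges (cycle_graph k))" by (simp add: E bij_betw_def)
  define m where "m = (if w \<in> f ` {..<k} then SOME i. i < k \<and> f i = w else 0)"
  have m: "m < k \<and> (f m = w \<or> w \<notin> f ` {..<k})"
  proof (cases "w \<in> f ` {..<k}")
    case True
    then have "\<exists>i. i < k \<and> f i = w" by auto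
    from someI_ex[OF this] show ?thesis using True by (simp add: m_def)
  next
    case False
    then show ?thesis using k by (simp add: m_def)
  qed
  define s where "s i = (i + m) mod k" for i
  have inj_s: "inj_on s {..<k}"
    unfolding s_def
  proof (rule inj_onI)
    fix i j assume ij: "i \<in> {..<k}" "j \<in> {..<k}" "(i + m) mod k = (j + m) mod k"
    have "(n + m) mod k = (if n + m < k then n + m else n + m - k)" if "n < k" for n
      using that m by (auto simp: mod_if)
    then show "i = j" using ij m by (auto split: if_splits)
  qed
  have s_lt: "s i < k" for i using k by (simp add: s_def)
  have bij_s: "bij_betw s {..<k} {..<k}"
    using inj_s s_lt endo_inj_surj[of "{..<k}" s] by (auto simp: bij_betw_def)
  have s_Suc: "s (Suc i mod k) = Suc (s i) mod k" for i
    by (simp add: s_def mod_simps)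
  show ?thesis
  proof (rule that[of "f \<circ> s" "\<phi> \<circ> ?e \<circ> s"])
    show "inj_on (f \<circ> s) {..<k}"
      using f(1) bij_s by (intro comp_inj_on) (auto simp: V bij_betw_def)
    show "(f \<circ> s) ` {..<k} \<subseteq> verts H" using f(2) s_lt by (auto simp: V)
    show "bij_betw (\<phi> \<circ> ?e \<circ> s) {..<k} (edges H)"
      using bij_betw_trans[OF bij_betw_trans[OF bij_s e] \<phi>] by (simp add: comp_assoc)
    show "{(f \<circ> s) i, (f \<circ> s) (Suc i mod k)} \<subseteq> (\<phi> \<circ> ?e \<circ> s) i" if "i < k" for i
      using sub[of "?e (s i)"] s_lt[of i] E by (auto simp: s_Suc)
    show "(f \<circ> s) 0 = w \<or> w \<notin> (f \<circ> s) ` {..<k}"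
      using m s_lt by (auto simp: s_def)
  qed
qed

text \<open>
  The case where the heaviest vertex \<open>w\<close> lies on the cycle, between \<open>d\<close> and \<open>a\<close>; the neighbouring cycle
  vertices are \<open>c, d, w, a, b\<close>. The edge \<open>{w, a, t0}\<close> yields the link edge \<open>{a, t0}\<close>. If \<open>t0 = b\<close>, this
  collides with the link edge \<open>{a, b}\<close> obtained from \<open>{a, b, t1}\<close>; then \<open>{a, b, t1}\<close> is bounded by
  \<open>{w, a, t1}\<close> instead, and \<open>t1 \<noteq> w\<close> because the two edges differ. The same is done at the other side.
  If both sides then produce \<open>{a, d}\<close>, one of the edges used came from an exchange and is bounded by a
  different pair of its vertices.
\<close>

lemma corner_exchange:
  fixes x :: "'a \<Rightarrow> real"
  assumes dist: "distinct [w, a, b, c, d]"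
    and t: "t0 \<notin> {w, a}" "t1 \<notin> {a, b}" "t2 \<notin> {c, d}" "t3 \<notin> {d, w}"
    and ne: "{w, a, t0} \<noteq> {a, b, t1}" "{w, a, t0} \<noteq> {d, w, t3}" "{c, d, t2} \<noteq> {d, w, t3}"
    and x: "\<And>z. 0 \<le> x z" "\<And>z. z \<in> {a, b, c, d, t0, t1, t2, t3} \<Longrightarrow> x z \<le> x w"
  shows "\<exists>u u'. {u, u'} \<subseteq> {a, b, c, d, t0, t1, t2, t3} - {w} \<and> u \<notin> {a, b} \<and> u' \<notin> {c, d} \<and>
    \<not> (u = d \<and> u' = a) \<and>
    x w * x a * x t0 + x a * x b * x t1 + x c * x d * x t2 + x d * x w * x t3 \<le>
    x w * (x u * x a) + x w * (x a * x b) + x w * (x c * x d) + x w * (x d * x u')"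
proof -
  have up: "x y * x z * x t \<le> x w * (x y * x z)" if "t \<in> {a, b, c, d, t0, t1, t2, t3}" for y z t
    using mult_left_mono[OF x(2)[OF that], of "x y * x z"] x(1)[of y] x(1)[of z] by (simp add: mult_ac)
  define u where "u = (if t0 = b then t1 else t0)"
  define u' where "u' = (if t3 = c then t2 else t3)"
  have u: "u \<noteq> w" "u \<notin> {a, b}" "u \<in> {t0, t1}"
    using t ne by (auto simp: u_def)
  have u': "u' \<noteq> w" "u' \<notin> {c, d}" "u' \<in> {t2, t3}"
    using t ne by (auto simp: u'_def)
  have head: "x w * x a * x t0 + x a * x b * x t1 \<le> x w * (x u * x a) + x w * (x a * x b)"
  proof (cases "t0 = b")
    case True
    then show ?thesis using up[of b a t1] by (simp add: u_def mult_ac)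
  next
    case False
    then show ?thesis using up[of t1 a b] by (simp add: u_def mult_ac)
  qed
  have tail: "x c * x d * x t2 + x d * x w * x t3 \<le> x w * (x c * x d) + x w * (x d * x u')"
  proof (cases "t3 = c")
    case True
    then show ?thesis using up[of c d t2] by (simp add: u'_def mult_ac)
  next
    case False
    then show ?thesis using up[of t2 c d] by (simp add: u'_def mult_ac)
  qed
  show ?thesis
  proof (cases "u = d \<and> u' = a")
    case False
    then show ?thesis using u u' head tail by (intro exI[of _ u] exI[of _ u']) auto
  next
    case double: True
    show ?thesis
    proof (cases "t0 = b")
      case True
      then have "t1 = d" using double by (simp add: u_def)
      have "x c * x d * x t2 + x d * x w * x t3 \<le> x w * (x c * x d) + x w * (x d * x a)"
        using tail double by simp
      moreover have "x a * x b * x t1 \<le> x w * (x d * x b)"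
        using up[of a b d] \<open>t1 = d\<close> by (simp add: mult_ac)
      ultimately show ?thesis
        using True dist by (intro exI[of _ d] exI[of _ b]) (auto simp: mult_ac)
    next
      case False
      then have "t0 = d" using double by (simp add: u_def)
      have "t3 = c"
      proof (rule ccontr)
        assume "t3 \<noteq> c"
        then have "t3 = a" using double by (simp add: u'_def)
        then show False using ne(2) \<open>t0 = d\<close> by auto
      qed
      then have "t2 = a" using double by (simp add: u'_def)
      have "x a * x b * x t1 \<le> x w * (x a * x b)" using up[of t1 a b] by simp
      moreover have "x c * x d * x t2 \<le> x w * (x c * x a)"
        using up[of d c a] \<open>t2 = a\<close> by (simp add: mult_ac)
      ultimately show ?thesis
        using \<open>t0 = d\<close> \<open>t3 = c\<close> dist by (intro exI[of _ c] exI[of _ a]) (auto simp: mult_ac)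
    qed
  qed
qed

lemma sum_split_corners:
  fixes g :: "nat \<Rightarrow> real"
  assumes "6 \<le> k"
  shows "(\<Sum>i<k. g i) = g 0 + g 1 + g (k - 2) + g (k - 1) + (\<Sum>i\<in>{2..<k-2}. g i)"
proof -
  have "{..<k} = {0, 1, k - 2, k - 1} \<union> {2..<k-2}" using assms by auto
  moreover have "(\<Sum>i\<in>{0, 1, k - 2, k - 1}. g i) = g 0 + g 1 + g (k - 2) + g (k - 1)"
  proof -
    have "1 \<noteq> k - 2" "1 \<noteq> k - 1" "k - 2 \<noteq> k - 1" "0 \<noteq> k - 2" "0 \<noteq> k - 1" using assms by linarith+
    then show ?thesis by simp
  qed
  moreover have "{0, 1, k - 2, k - 1} \<inter> {2..<k-2} = {}" using assms by auto
  ultimately show ?thesis by (simp only: sum.union_disjoint finite.intros finite_insert finite_atLeastLessThan)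
qed

lemma third_vertex:
  assumes "card e = 3" "y \<noteq> z" "{y, z} \<subseteq> e"
  obtains t where "e = {y, z, t}" "t \<notin> {y, z}"
proof -
  have "card (e - {y, z}) = 1"
    using assms by (simp add: card_Diff_subset)
  then obtain t where "e - {y, z} = {t}" by (auto simp: card_1_singleton_iff)
  then show ?thesis using assms by (intro that[of t]) auto
qed

text \<open>
  If \<open>w\<close> is off the cycle, every third vertex may be replaced by \<open>w\<close> and the link is the cycle itself,
  read as a path with both additional edges at \<open>v 0\<close>. Otherwise \<open>v 0 = w\<close>, and only the four edges next
  to \<open>w\<close> need the care of \<open>corner_exchange\<close>.
\<close>

lemma Berge_edge_sum_le:
  fixes x :: "'a \<Rightarrow> real"
  assumes k: "6 \<le> k" and H: "uniform_hypergraph 3 H"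
    and v: "inj_on v {..<k}" "v ` {..<k} \<subseteq> verts H" and E: "bij_betw E {..<k} (edges H)"
    and vE: "\<And>i. i < k \<Longrightarrow> {v i, v (Suc i mod k)} \<subseteq> E i"
    and w: "v 0 = w \<or> w \<notin> v ` {..<k}"
    and x: "\<And>z. 0 \<le> x z" "\<And>z. z \<in> verts H \<Longrightarrow> x z \<le> x w"
  obtains u u' where "looped_path k v u u'" "{u, u'} \<subseteq> verts H - {w}"
    "edge_sum H x \<le> x w * (\<Sum>i<k. x (looped_path.l v u i) * x (looped_path.r k v u' i))"
proof -
  have v_eq: "v i = v j \<longleftrightarrow> i = j" if "i < k" "j < k" for i j
    using v(1) that by (auto simp: inj_on_def)
  have EH: "E i \<in> edges H" if "i < k" for i using E that by (auto simp: bij_betw_def)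
  have E_eq: "E i = E j \<longleftrightarrow> i = j" if "i < k" "j < k" for i j
    using E that by (auto simp: bij_betw_def inj_on_def)
  have "\<exists>t. E i = {v i, v (Suc i mod k), t} \<and> t \<notin> {v i, v (Suc i mod k)}" if "i < k" for i
  proof -
    have "v i \<noteq> v (Suc i mod k)" using that k by (subst v_eq) (auto simp: mod_if)
    then show ?thesis
      using third_vertex[OF uniform_finite(5)[OF H EH[OF that]] _ vE[OF that]] by metis
  qed
  then obtain t where t: "\<And>i. i < k \<Longrightarrow> E i = {v i, v (Suc i mod k), t i}"
    "\<And>i. i < k \<Longrightarrow> t i \<notin> {v i, v (Suc i mod k)}" by metis
  define P where "P i = x (v i) * x (v (Suc i mod k)) * x (t i)" for i
  have sum_P: "edge_sum H x = (\<Sum>i<k. P i)"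
  proof -
    have "edge_sum H x = (\<Sum>i<k. \<Prod>z\<in>E i. x z)"
      unfolding edge_sum_def using sum.reindex_bij_betw[OF E, of "\<lambda>e. \<Prod>z\<in>e. x z"] by simp
    also have "\<dots> = (\<Sum>i<k. P i)"
    proof (rule sum.cong)
      fix i assume i: "i \<in> {..<k}"
      have "v i \<noteq> v (Suc i mod k)" using i k by (subst v_eq) (auto simp: mod_if)
      moreover have "v i \<noteq> t i" "v (Suc i mod k) \<noteq> t i" using t(2)[of i] i by auto
      ultimately show "(\<Prod>z\<in>E i. x z) = P i" using t(1)[of i] i by (simp add: P_def mult.assoc)
    qed simp
    finally show ?thesis .
  qed
  have tV: "t i \<in> verts H" if "i < k" for i
    using uniform_finite(4)[OF H EH[OF that]] t(1)[OF that] by auto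
  have vV: "v i \<in> verts H" if "i < k" for i using v(2) that by auto
  have P_le: "P i \<le> x w * (x (v i) * x (v (Suc i mod k)))" if "i < k" for i
    using mult_left_mono[OF x(2)[OF tV[OF that]], of "x (v i) * x (v (Suc i mod k))"] x(1)
    by (simp add: P_def mult_ac)
  have inj1: "inj_on v {1..<k}" using v(1) by (rule inj_on_subset) auto
  show ?thesis
  proof (cases "v 0 = w")
    case False
    have path: "looped_path k v (v 0) (v 0)"
      using k inj1 by unfold_locales (simp_all add: v_eq)
    show ?thesis
    proof (rule that[OF path])
      show "{v 0, v 0} \<subseteq> verts H - {w}" using False vV k by auto
      have "P i \<le> x w * (x (looped_path.l v (v 0) i) * x (looped_path.r k v (v 0) i))" if "i < k" for i
      proof -
        have "Suc i mod k = (if i = k - 1 then 0 else Suc i)" using that k by auto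
        then show ?thesis
          using P_le[OF that] by (auto simp: looped_path.l_def[OF path] looped_path.r_def[OF path])
      qed
      then show "edge_sum H x \<le>
          x w * (\<Sum>i<k. x (looped_path.l v (v 0) i) * x (looped_path.r k v (v 0) i))"
        unfolding sum_P sum_distrib_left by (intro sum_mono) auto
    qed
  next
    case True
    have S: "Suc 0 mod k = 1" "Suc 1 mod k = 2" "Suc (k - 2) mod k = k - 1" "Suc (k - 1) mod k = 0"
      using k by (auto simp: numeral_2_eq_2 Suc_diff_Suc)
    have kk: "0 < k" "1 < k" "2 < k" "k - 2 < k" "k - 1 < k" using k by auto
    note E0 = t[OF kk(1), unfolded S(1) True] and E1 = t[OF kk(2), unfolded S(2)]
      and E2 = t[OF kk(4), unfolded S(3)] and E3 = t[OF kk(5), unfolded S(4) True]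
    have "distinct [w, v 1, v 2, v (k - 2), v (k - 1)]"
      unfolding True[symmetric] using k by (simp add: v_eq) presburger
    moreover have "t 0 \<notin> {w, v 1}" "t 1 \<notin> {v 1, v 2}" "t (k - 2) \<notin> {v (k - 2), v (k - 1)}"
      "t (k - 1) \<notin> {v (k - 1), w}" using E0 E1 E2 E3 by simp_all
    moreover have "{w, v 1, t 0} \<noteq> {v 1, v 2, t 1}" "{w, v 1, t 0} \<noteq> {v (k - 1), w, t (k - 1)}"
      "{v (k - 2), v (k - 1), t (k - 2)} \<noteq> {v (k - 1), w, t (k - 1)}"
      using E0(1) E1(1) E2(1) E3(1) E_eq[OF kk(1,2)] E_eq[OF kk(1,5)] E_eq[OF kk(4,5)] k by auto
    moreover have "x z \<le> x w"
      if "z \<in> {v 1, v 2, v (k - 2), v (k - 1), t 0, t 1, t (k - 2), t (k - 1)}" for z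
      using that kk by (intro x(2)) (auto intro: vV tV)
    ultimately obtain u u' where
      u_mem: "{u, u'} \<subseteq> {v 1, v 2, v (k - 2), v (k - 1), t 0, t 1, t (k - 2), t (k - 1)} - {w}"
      and u: "u \<notin> {v 1, v 2}" "u' \<notin> {v (k - 2), v (k - 1)}" "\<not> (u = v (k - 1) \<and> u' = v 1)"
      and le: "x w * x (v 1) * x (t 0) + x (v 1) * x (v 2) * x (t 1) +
        x (v (k - 2)) * x (v (k - 1)) * x (t (k - 2)) + x (v (k - 1)) * x w * x (t (k - 1)) \<le>
        x w * (x u * x (v 1)) + x w * (x (v 1) * x (v 2)) +
        x w * (x (v (k - 2)) * x (v (k - 1))) + x w * (x (v (k - 1)) * x u')"
      using corner_exchange[of w "v 1" "v 2" "v (k - 2)" "v (k - 1)" "t 0" "t 1" "t (k - 2)" "t (k - 1)" x] x(1)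
      by metis
    have path: "looped_path k v u u'"
      using k inj1 u by unfold_locales auto
    define Q where "Q i = x w * (x (looped_path.l v u i) * x (looped_path.r k v u' i))" for i
    note lr = looped_path.l_def[OF path] looped_path.r_def[OF path]
    have corners: "P 0 + P 1 + P (k - 2) + P (k - 1) \<le> Q 0 + Q 1 + Q (k - 2) + Q (k - 1)"
    proof -
      have "Q 0 = x w * (x u * x (v 1))" "Q 1 = x w * (x (v 1) * x (v 2))"
        "Q (k - 2) = x w * (x (v (k - 2)) * x (v (k - 1)))" "Q (k - 1) = x w * (x (v (k - 1)) * x u')"
        using k by (auto simp: Q_def lr numeral_2_eq_2 Suc_diff_Suc)
      moreover have "P 0 = x w * x (v 1) * x (t 0)" "P 1 = x (v 1) * x (v 2) * x (t 1)"
        "P (k - 2) = x (v (k - 2)) * x (v (k - 1)) * x (t (k - 2))"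
        "P (k - 1) = x (v (k - 1)) * x w * x (t (k - 1))"
        unfolding P_def S True by simp_all
      ultimately show ?thesis using le by simp
    qed
    have "P i \<le> Q i" if "i \<in> {2..<k-2}" for i
    proof -
      have "i < k" "Suc i mod k = Suc i" "i \<noteq> 0" "i \<noteq> k - 1" using that by auto
      then show ?thesis using P_le[of i] by (simp add: Q_def lr)
    qed
    then have "(\<Sum>i\<in>{2..<k-2}. P i) \<le> (\<Sum>i\<in>{2..<k-2}. Q i)" by (rule sum_mono)
    then have "(\<Sum>i<k. P i) \<le> (\<Sum>i<k. Q i)"
      unfolding sum_split_corners[OF k, of P] sum_split_corners[OF k, of Q] using corners by linarith
    moreover have "{u, u'} \<subseteq> verts H - {w}" using u_mem vV tV kk by auto
    ultimately show ?thesis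
      using path by (intro that[of u u']) (auto simp: sum_P Q_def sum_distrib_left)
  qed
qed

text \<open>
  Extending the weights by zero beyond the last rank makes them a decreasing sequence on all natural
  numbers, as \<open>edge_sum_le_core\<close> requires.
\<close>

lemma edge_sum_le_core_edge_sum:
  fixes x :: "'a \<Rightarrow> real"
  assumes k: "6 \<le> k" and H: "uniform_hypergraph 3 H" and B: "is_Berge (cycle_graph k) H"
    and x: "\<And>z. 0 \<le> x z"
    and h: "bij_betw h {..<card (verts H)} (verts H)"
    and sorted: "\<And>i j. i \<le> j \<Longrightarrow> j < card (verts H) \<Longrightarrow> x (h j) \<le> x (h i)"
  shows "k \<le> card (verts H)" "edge_sum H x \<le> edge_sum (core_hypergraph k h) x"
proof -
  let ?n = "card (verts H)"
  have "3 \<le> k" using k by simp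
  from Berge_cycle_edges[OF this B, of "h 0"] obtain v E where
    v: "inj_on v {..<k}" "v ` {..<k} \<subseteq> verts H" and E: "bij_betw E {..<k} (edges H)"
    and vE: "\<And>i. i < k \<Longrightarrow> {v i, v (Suc i mod k)} \<subseteq> E i"
    and w: "v 0 = h 0 \<or> h 0 \<notin> v ` {..<k}" by blast
  show kn: "k \<le> ?n"
    using card_mono[OF uniform_finite(1)[OF H] v(2)] card_image[OF v(1)] by simp
  define \<rho> where "\<rho> = the_inv_into {..<?n} h"
  have inj_h: "inj_on h {..<?n}" and img_h: "h ` {..<?n} = verts H"
    using h by (auto simp: bij_betw_def)
  have \<rho>: "h (\<rho> z) = z" "\<rho> z < ?n" if "z \<in> verts H" for z
    using that f_the_inv_into_f_bij_betw[OF h, of z] the_inv_into_into[OF inj_h, of z "{..<?n}"]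
    by (auto simp: \<rho>_def img_h)
  have le_w: "x z \<le> x (h 0)" if "z \<in> verts H" for z
    using sorted[of 0 "\<rho> z"] \<rho>[OF that] by simp
  obtain u u' where path: "looped_path k v u u'" and ends_V: "{u, u'} \<subseteq> verts H - {h 0}"
    and le: "edge_sum H x \<le>
      x (h 0) * (\<Sum>i<k. x (looped_path.l v u i) * x (looped_path.r k v u' i))"
    using Berge_edge_sum_le[where v = v and E = E and w = "h 0" and x = x, OF k H v E vE w x le_w] by blast
  interpret looped_path k v u u' by (rule path)
  define a where "a n = (if n < ?n then x (h n) else 0)" for n
  have a: "decseq a" "0 \<le> a n" for n
    using sorted x by (auto simp: a_def decseq_def)
  have vw: "v i \<noteq> h 0" if "1 \<le> i" "i < k" for i
  proof
    assume "v i = h 0"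
    then have "v 0 = v i" using w that by (metis imageI lessThan_iff)
    then show False using inj_onD[OF v(1), of 0 i] that by auto
  qed
  have lr: "l i \<in> verts H - {h 0}" "r i \<in> verts H - {h 0}" if "i < k" for i
  proof -
    have "v j \<in> verts H - {h 0}" if "1 \<le> j" "j < k" for j using vw v(2) that by auto
    then show "l i \<in> verts H - {h 0}" "r i \<in> verts H - {h 0}"
      using that ends_V k by (auto simp: l_def r_def)
  qed
  have a_\<rho>: "a (\<rho> z) = x z" if "z \<in> verts H" for z
    using \<rho>[OF that] by (simp add: a_def)
  have "(\<Sum>i<k. x (l i) * x (r i)) = (\<Sum>i<k. a (\<rho> (l i)) * a (\<rho> (r i)))"
    using lr by (intro sum.cong refl) (simp add: a_\<rho>)
  also have "\<dots> \<le> (\<Sum>j<k. a (core_l j) * a (core_r k j))"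
  proof (rule edge_sum_le_core[OF a])
    have sub: "l ` {..<k} \<union> r ` {..<k} \<subseteq> verts H - {h 0}" using lr by auto
    show "inj_on \<rho> (l ` {..<k} \<union> r ` {..<k})"
      using \<rho>(1) sub by (intro inj_on_inverseI[where g = h]) blast
    show "1 \<le> \<rho> z" if "z \<in> l ` {..<k} \<union> r ` {..<k}" for z
    proof (rule ccontr)
      assume "\<not> 1 \<le> \<rho> z"
      then have "\<rho> z = 0" by simp
      then show False using \<rho>(1)[of z] sub that by auto
    qed
  qed
  also have "\<dots> = (\<Sum>j<k. x (h (core_l j)) * x (h (core_r k j)))"
    using core_ends[OF k] kn by (intro sum.cong refl) (force simp: a_def)
  finally have "x (h 0) * (\<Sum>i<k. x (l i) * x (r i)) \<le>
      x (h 0) * (\<Sum>j<k. x (h (core_l j)) * x (h (core_r k j)))"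
    using x by (intro mult_left_mono) auto
  also have "\<dots> = edge_sum (core_hypergraph k h) x"
    unfolding edge_sum_def
    using kn by (intro core_hypergraph_edge_sum[symmetric] k inj_on_subset[OF inj_h]) auto
  finally show "edge_sum H x \<le> edge_sum (core_hypergraph k h) x" using le by simp
qed

section \<open>The case of equality\<close>

lemma link_sum_common_vertex:
  fixes x :: "'a \<Rightarrow> real" and k :: nat
  assumes E: "bij_betw E {..<k} (edges H)" "\<And>i. i < k \<Longrightarrow> E i = {w, l i, r i}"
    and dist: "\<And>i. i < k \<Longrightarrow> distinct [w, l i, r i]" and z: "z \<noteq> w"
  shows "link_sum H x z =
    x w * ((\<Sum>i\<in>{i\<in>{..<k}. l i = z}. x (r i)) + (\<Sum>i\<in>{i\<in>{..<k}. r i = z}. x (l i)))"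
proof -
  have "bij_betw E {i\<in>{..<k}. z \<in> E i} {e\<in>edges H. z \<in> e}"
    using E(1) unfolding bij_betw_def inj_on_def by blast
  then have "link_sum H x z = (\<Sum>i\<in>{i\<in>{..<k}. z \<in> E i}. \<Prod>y\<in>E i - {z}. x y)"
    unfolding link_sum_def by (rule sum.reindex_bij_betw[symmetric])
  also have "{i\<in>{..<k}. z \<in> E i} = {i\<in>{..<k}. l i = z} \<union> {i\<in>{..<k}. r i = z}"
    using E(2) z by auto
  also have "(\<Sum>i\<in>\<dots>. \<Prod>y\<in>E i - {z}. x y) =
      (\<Sum>i\<in>{i\<in>{..<k}. l i = z}. \<Prod>y\<in>E i - {z}. x y) + (\<Sum>i\<in>{i\<in>{..<k}. r i = z}. \<Prod>y\<in>E i - {z}. x y)"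
  proof (rule sum.union_disjoint)
    have "l i \<noteq> r i" if "i < k" for i using dist[OF that] by simp
    then show "{i\<in>{..<k}. l i = z} \<inter> {i\<in>{..<k}. r i = z} = {}" by force
  qed simp_all
  also have "(\<Sum>i\<in>{i\<in>{..<k}. l i = z}. \<Prod>y\<in>E i - {z}. x y) = (\<Sum>i\<in>{i\<in>{..<k}. l i = z}. x w * x (r i))"
  proof (intro sum.cong refl)
    fix i assume "i \<in> {i\<in>{..<k}. l i = z}"
    then have i: "i < k" "l i = z" by auto
    then have "E i - {z} = {w, r i}" "w \<noteq> r i" using E(2)[OF i(1)] dist[OF i(1)] by auto
    then show "(\<Prod>y\<in>E i - {z}. x y) = x w * x (r i)" by simp
  qed
  also have "(\<Sum>i\<in>{i\<in>{..<k}. r i = z}. \<Prod>y\<in>E i - {z}. x y) = (\<Sum>i\<in>{i\<in>{..<k}. r i = z}. x w * x (l i))"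
  proof (intro sum.cong refl)
    fix i assume "i \<in> {i\<in>{..<k}. r i = z}"
    then have i: "i < k" "r i = z" by auto
    then have "E i - {z} = {w, l i}" "w \<noteq> l i" using E(2)[OF i(1)] dist[OF i(1)] by auto
    then show "(\<Prod>y\<in>E i - {z}. x y) = x w * x (l i)" by simp
  qed
  finally show ?thesis by (simp add: sum_distrib_left distrib_left)
qed

lemma core_link_sums:
  assumes k: "6 \<le> k" and h: "inj_on h {..<k}"
  defines "D \<equiv> core_hypergraph k h"
  shows "link_sum D x (h 1) = x (h 0) * (x (h 2) + x (h 3) + x (h 4) + x (h 5))"
    and "link_sum D x (h 2) = x (h 0) * (x (h 1) + x (h 3))"
    and "link_sum D x (h 3) = x (h 0) * (x (h 1) + x (h 2))"
proof -
  have heq: "h i = h j \<longleftrightarrow> i = j" if "i < k" "j < k" for i j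
    using h that by (auto simp: inj_on_def)
  have link: "link_sum D x (h m) = x (h 0) *
      ((\<Sum>i\<in>{i\<in>{..<k}. core_l i = m}. x (h (core_r k i))) + (\<Sum>i\<in>{i\<in>{..<k}. core_r k i = m}. x (h (core_l i))))"
    if m: "1 \<le> m" "m < k" for m
  proof -
    have "link_sum D x (h m) = x (h 0) *
      ((\<Sum>i\<in>{i\<in>{..<k}. h (core_l i) = h m}. x (h (core_r k i))) +
       (\<Sum>i\<in>{i\<in>{..<k}. h (core_r k i) = h m}. x (h (core_l i))))"
    proof (rule link_sum_common_vertex)
      show "bij_betw (\<lambda>j. {h 0, h (core_l j), h (core_r k j)}) {..<k} (edges D)"
        using core_hypergraph_edges_distinct[OF k h] by (simp add: bij_betw_def D_def core_hypergraph_def)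
      show "distinct [h 0, h (core_l i), h (core_r k i)]" if "i < k" for i
        using core_ends[OF k that] k by (simp add: heq)
      show "h m \<noteq> h 0" using m k by (simp add: heq)
    qed simp
    moreover have "core_l i < k" if "i < k" for i using core_ends(2,3)[OF k that] by linarith
    then have "{i\<in>{..<k}. h (core_l i) = h m} = {i\<in>{..<k}. core_l i = m}"
      "{i\<in>{..<k}. h (core_r k i) = h m} = {i\<in>{..<k}. core_r k i = m}"
      using core_ends(3)[OF k] m by (auto simp: heq cong: conj_cong)
    ultimately show ?thesis by simp
  qed
  have L: "{i\<in>{..<k}. core_l i = 1} = {0, 1, 3, 4}" "{i\<in>{..<k}. core_l i = 2} = {2}"
    "{i\<in>{..<k}. core_l i = 3} = {}"
    using k by (auto simp: core_l_def split: if_splits)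
  have R: "{i\<in>{..<k}. core_r k i = 1} = {}" "{i\<in>{..<k}. core_r k i = 2} = {0}"
    "{i\<in>{..<k}. core_r k i = 3} = {1, 2}"
    using k by (auto simp: core_r_def split: if_splits)
  show "link_sum D x (h 1) = x (h 0) * (x (h 2) + x (h 3) + x (h 4) + x (h 5))"
    using link[of 1] k unfolding L R by (simp add: core_small)
  show "link_sum D x (h 2) = x (h 0) * (x (h 1) + x (h 3))"
    using link[of 2] k unfolding L R by (simp add: core_small)
  show "link_sum D x (h 3) = x (h 0) * (x (h 1) + x (h 2))"
    using link[of 3] k unfolding L R by (simp add: core_small)
qed

lemma sum_distinct_ranks_le:
  fixes a :: "nat \<Rightarrow> real"
  assumes I: "finite I" and f: "inj_on f I" "\<And>i. i \<in> I \<Longrightarrow> m \<le> f i"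
    and a: "decseq a" "\<And>n. 0 \<le> a n" and c: "card I \<le> c"
  shows "(\<Sum>i\<in>I. a (f i)) \<le> (\<Sum>j\<in>{m..<m + c}. a j)"
proof -
  have "(\<Sum>i\<in>I. 1 * a (f i)) \<le> (\<Sum>j\<in>{m..<m + c}. 1 * a j)"
  proof (rule weighted_sum_dominated[OF I _ a])
    fix s
    have "card {i\<in>I. f i \<le> s} \<le> card {j\<in>{m..<m + c}. j \<le> s}"
    proof (cases "s < m + c")
      case True
      have "card {i\<in>I. f i \<le> s} = card (f ` {i\<in>I. f i \<le> s})"
        by (rule card_image[symmetric]) (rule inj_on_subset[OF f(1)], auto)
      also have "\<dots> \<le> card {j\<in>{m..<m + c}. j \<le> s}"
        using f(2) True by (intro card_mono) auto
      finally show ?thesis .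
    next
      case False
      then have "{j\<in>{m..<m + c}. j \<le> s} = {m..<m + c}" by auto
      moreover have "card {i\<in>I. f i \<le> s} \<le> card I" using I by (intro card_mono) auto
      ultimately show ?thesis using c by simp
    qed
    then show "(\<Sum>i\<in>{i\<in>I. f i \<le> s}. 1) \<le> (\<Sum>j\<in>{j\<in>{m..<m + c}. j \<le> s}. 1::real)" by simp
  qed simp
  then show ?thesis by simp
qed


text \<open>
  The function \<open>\<mu>\<close> stands for \<open>t \<mapsto> \<lambda> t\<^bsup>p-1\<^esup>\<close>; what matters is that equal weights have equal link sums
  and that \<open>H\<close> and the sorted copy share these sums. So the neighbours in \<open>H\<close> can be found by their weights, although ties
  may prevent identifying them with those in the copy. The vertex \<open>c\<close> of rank 1 is strictly heavier than
  all others except \<open>w\<close>, so its weight does identify it.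
\<close>

lemma extremal_Berge_cycle_iso:
  fixes x :: "'a \<Rightarrow> real"
  assumes k: "6 \<le> k" and H: "uniform_hypergraph 3 H" and B: "is_Berge (cycle_graph k) H"
    and h: "bij_betw h {..<k} (verts H)"
    and sorted: "\<And>i j. i \<le> j \<Longrightarrow> j < k \<Longrightarrow> x (h j) \<le> x (h i)"
    and pos: "\<And>z. z \<in> verts H \<Longrightarrow> 0 < x z"
    and sums: "edge_sum H x = edge_sum (core_hypergraph k h) x"
    and eigen: "\<And>z. z \<in> verts H \<Longrightarrow> link_sum H x z = \<mu> (x z)"
      "\<And>z. z \<in> verts H \<Longrightarrow> link_sum (core_hypergraph k h) x z = \<mu> (x z)"
  shows "H \<simeq>\<^sub>H suspension (Delta2 k)"
proof -
  define D where "D = core_hypergraph k h"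
  define w where "w = h 0"
  have inj_h: "inj_on h {..<k}" and img_h: "h ` {..<k} = verts H"
    using h by (auto simp: bij_betw_def)
  have hV: "h i \<in> verts H" if "i < k" for i using img_h that by auto
  have wV: "w \<in> verts H" using hV[of 0] k by (simp add: w_def)
  note finH = uniform_finite[OF H]
  have D_uniform: "uniform_hypergraph 3 D" unfolding D_def by (rule core_hypergraph_uniform[OF k inj_h])
  \<comment> \<open>All edges of the copy contain \<open>w\<close>, so its edge sum is \<open>x w\<close> times the link sum at \<open>w\<close>. In \<open>H\<close> an
    edge without \<open>w\<close> would add a positive term to the same value.\<close>
  have w_all: "w \<in> e" if "e \<in> edges H" for e
  proof -
    have split: "edge_sum G x = (\<Sum>e\<in>{e\<in>edges G. w \<notin> e}. \<Prod>i\<in>e. x i) + x w * link_sum G x w"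
      if "uniform_hypergraph 3 G" for G
      using edge_sum_update[OF that, of x w "x w"] by simp
    have "{e\<in>edges D. w \<notin> e} = {}" by (auto simp: D_def core_hypergraph_def w_def)
    then have "edge_sum D x = x w * link_sum D x w" using split[OF D_uniform] by (simp only: sum.empty)
    moreover have "link_sum D x w = link_sum H x w" using eigen wV by (simp add: D_def)
    ultimately have zero: "(\<Sum>e\<in>{e\<in>edges H. w \<notin> e}. \<Prod>i\<in>e. x i) = 0"
      using split[OF H] sums by (simp add: D_def)
    have prod_pos: "0 < (\<Prod>i\<in>e. x i)" if "e \<in> edges H" for e
      using finH(4)[OF that] pos by (intro prod_pos) auto
    show ?thesis
    proof (rule ccontr)
      assume "w \<notin> e"
      then have "(\<Prod>i\<in>e. x i) \<le> (\<Sum>e\<in>{e\<in>edges H. w \<notin> e}. \<Prod>i\<in>e. x i)"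
        using finH(2) that prod_pos by (intro member_le_sum) (auto intro: less_imp_le)
      then show False using zero prod_pos[OF that] by simp
    qed
  qed
  have "3 \<le> k" using k by simp
  from Berge_cycle_edges[OF this B, of w] obtain v E where
    v: "inj_on v {..<k}" "v ` {..<k} \<subseteq> verts H" and E: "bij_betw E {..<k} (edges H)"
    and vE: "\<And>i. i < k \<Longrightarrow> {v i, v (Suc i mod k)} \<subseteq> E i"
    and w_or: "v 0 = w \<or> w \<notin> v ` {..<k}" by blast
  have card_V: "card (verts H) = k" using card_image[OF inj_h] img_h by simp
  have img_v: "v ` {..<k} = verts H"
    using v card_image[OF v(1)] card_V finH(1) by (intro card_subset_eq) auto
  then have v0: "v 0 = w" using w_or wV by auto
  have v_eq: "v i = v j \<longleftrightarrow> i = j" if "i < k" "j < k" for i j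
    using v(1) that by (auto simp: inj_on_def)
  have vw: "v i \<noteq> w" if "1 \<le> i" "i < k" for i using v_eq[of i 0] that v0 by auto
  have EH: "E i \<in> edges H" if "i < k" for i using E that by (auto simp: bij_betw_def)
  have E_eq: "E i = E j \<longleftrightarrow> i = j" if "i < k" "j < k" for i j
    using E that by (auto simp: bij_betw_def inj_on_def)
  have E_mid: "E i = {w, v i, v (Suc i)}" if "1 \<le> i" "i < k - 1" for i
  proof -
    have "{w, v i, v (Suc i)} \<subseteq> E i" using vE[of i] w_all[OF EH[of i]] that by auto
    moreover have i: "i < k" "Suc i < k" using that by auto
    moreover have "w \<noteq> v i" "w \<noteq> v (Suc i)" "v i \<noteq> v (Suc i)"
      using vw[of i] vw[of "Suc i"] v_eq[of i "Suc i"] that i by auto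
    then have "card {w, v i, v (Suc i)} = 3" by simp
    ultimately show ?thesis
      using card_subset_eq[OF finH(3)[OF EH[of i]]] finH(5)[OF EH[of i]] by metis
  qed
  have ends_sub: "{w, v 1} \<subseteq> E 0" "{w, v (k - 1)} \<subseteq> E (k - 1)"
    using vE[of 0] vE[of "k - 1"] v0 k by auto
  have ends_ne: "w \<noteq> v 1" "w \<noteq> v (k - 1)" using vw[of 1] vw[of "k - 1"] k by force+
  have ends_card: "card (E 0) = 3" "card (E (k - 1)) = 3" using finH(5)[OF EH] k by auto
  obtain u where start: "E 0 = {w, v 1, u}" "u \<notin> {w, v 1}"
    using third_vertex[OF ends_card(1) ends_ne(1) ends_sub(1)] .
  obtain u' where final: "E (k - 1) = {w, v (k - 1), u'}" "u' \<notin> {w, v (k - 1)}"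
    using third_vertex[OF ends_card(2) ends_ne(2) ends_sub(2)] .
  have u2: "u \<noteq> v 2"
  proof
    assume "u = v 2"
    moreover have "E 1 = {w, v 1, v 2}"
      using E_mid[of 1] k by (simp add: numeral_2_eq_2)
    ultimately have "E 0 = E 1" using start(1) by simp
    then show False using E_eq[of 0 1] k by auto
  qed
  have u2': "u' \<noteq> v (k - 2)"
  proof
    assume "u' = v (k - 2)"
    moreover have "E (k - 2) = {w, v (k - 2), v (k - 1)}"
      using E_mid[of "k - 2"] k by (simp add: Suc_diff_Suc numeral_2_eq_2)
    ultimately have "E (k - 2) = E (k - 1)" using final(1) by auto
    then show False using E_eq[of "k - 2" "k - 1"] k by auto
  qed
  interpret looped_path k v u u'
  proof
    show "inj_on v {1..<k}" using v(1) by (rule inj_on_subset) auto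
    show "\<not> (u = v (k - 1) \<and> u' = v 1)"
    proof
      assume "u = v (k - 1) \<and> u' = v 1"
      then have "E 0 = E (k - 1)" using start(1) final(1) by auto
      then show False using E_eq[of 0 "k - 1"] k by auto
    qed
  qed (use k start final u2 u2' in auto)
  have E_lr: "E i = {w, l i, r i}" if i: "i < k" for i
  proof -
    consider "i = 0" | "1 \<le> i" "i < k - 1" | "i = k - 1" using i by linarith
    then show ?thesis
    proof cases
      case 1 then show ?thesis using start(1) k by (auto simp: l_def r_def)
    next
      case 2 then show ?thesis using E_mid[of i] by (simp add: l_def r_def)
    next
      case 3 then show ?thesis using final(1) k by (auto simp: l_def r_def)
    qed
  qed
  have lr_w: "distinct [w, l i, r i]" if "i < k" for i
  proof -
    have "l i \<noteq> w" using start(2) vw[of i] that by (auto simp: l_def)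
    moreover have "r i \<noteq> w" using final(2) vw[of "Suc i"] that by (auto simp: r_def)
    ultimately show ?thesis using no_loop[OF that] by auto
  qed
  have lr_V: "l i \<in> verts H" "r i \<in> verts H" if "i < k" for i
    using finH(4)[OF EH[OF that]] E_lr[OF that] by auto
  note link = link_sum_common_vertex[where w = w and l = l and r = r, OF E E_lr lr_w]
  define \<rho> where "\<rho> = the_inv_into {..<k} h"
  have \<rho>: "h (\<rho> z) = z" "\<rho> z < k" if "z \<in> verts H" for z
    using that f_the_inv_into_f_bij_betw[OF h, of z] the_inv_into_into[OF inj_h, of z "{..<k}"]
    by (auto simp: \<rho>_def img_h)
  define a where "a n = (if n < k then x (h n) else 0)" for n
  have a: "decseq a" "0 \<le> a n" for n
    using sorted pos[OF hV] by (auto simp: a_def decseq_def less_imp_le)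
  have a_\<rho>: "a (\<rho> z) = x z" if "z \<in> verts H" for z
    using \<rho>[OF that] by (simp add: a_def)
  have a_small: "a i = x (h i)" if "i \<le> 5" for i using that k by (simp add: a_def)
  have a5: "0 < a 5" using pos[OF hV[of 5]] k by (simp add: a_def)
  define c where "c = h 1"
  have cV: "c \<in> verts H" using hV[of 1] k by (simp add: c_def)
  have c_w: "c \<noteq> w" using inj_onD[OF inj_h, of 1 0] k by (auto simp: c_def w_def)
  have x_le: "x z \<le> a 2" if "z \<in> verts H" "z \<noteq> w" "z \<noteq> c" for z
  proof -
    have "\<rho> z \<noteq> 0" "\<rho> z \<noteq> 1" using \<rho>(1)[OF that(1)] that by (metis w_def, metis c_def)
    then have "2 \<le> \<rho> z" by linarith
    then show ?thesis using a(1) a_\<rho>[OF that(1)] by (metis decseqD)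
  qed
  note core_link = core_link_sums[OF k inj_h, folded D_def w_def c_def]
  have \<mu>: "\<mu> (a 1) = x w * (a 2 + a 3 + a 4 + a 5)" "\<mu> (a 2) = x w * (a 1 + a 3)"
    "\<mu> (a 3) = x w * (a 1 + a 2)"
    using core_link[of x] eigen(2)[OF hV, folded D_def] k by (simp_all add: a_small c_def)
  have xw: "0 < x w" by (rule pos[OF wV])
  have strict: "a 2 < a 1"
  proof (rule ccontr)
    assume "\<not> a 2 < a 1"
    then have "a 1 = a 2" using decseqD[OF a(1), of 1 2] by simp
    then have "a 2 + a 3 + a 4 + a 5 = a 1 + a 3" using \<mu> xw by simp
    then show False using \<open>a 1 = a 2\<close> a5 a(2)[of 4] by simp
  qed
  \<comment> \<open>The link neighbours of \<open>c\<close> have distinct ranks from 2 on, and their weights add up to those of the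
    ranks 2 to 5. So there must be four of them, which forces \<open>u = u' = c\<close>.\<close>
  define I where "I = {i\<in>{..<k}. l i = c \<or> r i = c}"
  define other where "other i = (if l i = c then r i else l i)" for i
  have finI: "finite I" by (simp add: I_def)
  have I_split: "I = {i\<in>{..<k}. l i = c} \<union> {i\<in>{..<k}. r i = c}"
    "{i\<in>{..<k}. l i = c} \<inter> {i\<in>{..<k}. r i = c} = {}"
    using no_loop by (force simp: I_def)+
  have other: "other i \<in> verts H" "other i \<noteq> w" "other i \<noteq> c" "{l i, r i} = {c, other i}" if "i \<in> I" for i
  proof -
    have i: "i < k" "l i = c \<or> r i = c" using that by (auto simp: I_def)
    then show "other i \<in> verts H" "other i \<noteq> w" "other i \<noteq> c" "{l i, r i} = {c, other i}"
      using lr_V[OF i(1)] lr_w[OF i(1)] no_loop[OF i(1)] by (auto simp: other_def)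
  qed
  have \<rho>_other: "inj_on (\<lambda>i. \<rho> (other i)) I"
  proof (rule inj_onI)
    fix i j assume ij: "i \<in> I" "j \<in> I" "\<rho> (other i) = \<rho> (other j)"
    then have "other i = other j" using \<rho>(1) other(1) by metis
    then have "{l i, r i} = {l j, r j}" using other(4) ij by simp
    then show "i = j" using inj_onD[OF edges_distinct] ij by (auto simp: I_def)
  qed
  have \<rho>_ge: "2 \<le> \<rho> (other i)" if "i \<in> I" for i
  proof -
    have "\<rho> (other i) \<noteq> 0" "\<rho> (other i) \<noteq> 1"
      using \<rho>(1)[OF other(1)[OF that]] other(2,3)[OF that] by (metis w_def, metis c_def)
    then show ?thesis by linarith
  qed
  have sum_I: "(\<Sum>i\<in>I. a (\<rho> (other i))) = a 2 + a 3 + a 4 + a 5"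
  proof -
    have "(\<Sum>i\<in>I. a (\<rho> (other i))) = (\<Sum>i\<in>I. x (other i))"
      using other(1) by (intro sum.cong refl) (simp add: a_\<rho>)
    also have "\<dots> = (\<Sum>i\<in>{i\<in>{..<k}. l i = c}. x (other i)) + (\<Sum>i\<in>{i\<in>{..<k}. r i = c}. x (other i))"
      unfolding I_split(1) by (rule sum.union_disjoint) (use I_split(2) in auto)
    also have "(\<Sum>i\<in>{i\<in>{..<k}. r i = c}. x (other i)) = (\<Sum>i\<in>{i\<in>{..<k}. r i = c}. x (l i))"
      using no_loop by (intro sum.cong refl) (force simp: other_def)
    also have "(\<Sum>i\<in>{i\<in>{..<k}. l i = c}. x (other i)) = (\<Sum>i\<in>{i\<in>{..<k}. l i = c}. x (r i))"
      by (intro sum.cong refl) (auto simp: other_def)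
    finally have "x w * (\<Sum>i\<in>I. a (\<rho> (other i))) = link_sum H x c"
      using link[OF _ _ c_w] by simp
    also have "\<dots> = \<mu> (a 1)" using eigen(1)[OF cV] by (simp add: a_small c_def)
    finally show ?thesis using \<mu>(1) xw by simp
  qed
  have card_I: "card I \<le> 2 + of_bool (u = c) + of_bool (u' = c)"
    using degree_sum_le[of "{c}"] card_Un_disjoint[OF _ _ I_split(2)] I_split(1) by simp
  have top: "(\<Sum>i\<in>I. a (\<rho> (other i))) \<le> (\<Sum>j\<in>{m..<m + n}. a j)"
    if "\<And>i. i \<in> I \<Longrightarrow> m \<le> \<rho> (other i)" "card I \<le> n" for m n
    by (rule sum_distinct_ranks_le[OF finI \<rho>_other that(1) a that(2)])
  have "\<not> card I \<le> 3"
  proof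
    assume "card I \<le> 3"
    then have "(\<Sum>i\<in>I. a (\<rho> (other i))) \<le> (\<Sum>j\<in>{2..<2 + 3}. a j)" by (intro top \<rho>_ge)
    also have "{2..<2 + 3} = {2, 3, 4::nat}" by auto
    finally show False using sum_I a5 by simp
  qed
  then have uc: "u = c" "u' = c" and card4: "card I = 4"
    using card_I by (auto split: if_splits simp: of_bool_def)
  \<comment> \<open>If no neighbour has rank 2, then the weights of the ranks 3 to 6 add up to at least those of the ranks
    2 to 5, so all of them are tied.\<close>
  obtain i where i: "i \<in> I" "x (other i) = a 2"
  proof (cases "\<exists>i\<in>I. \<rho> (other i) = 2")
    case True
    then obtain i where "i \<in> I" "\<rho> (other i) = 2" by blast
    then show ?thesis using that a_\<rho>[OF other(1)] by metis
  next
    case False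
    then have "3 \<le> \<rho> (other i)" if "i \<in> I" for i using \<rho>_ge[OF that] that by (metis Suc_leI le_neq_implies_less eval_nat_numeral(3) numeral_2_eq_2 eval_nat_numeral(2))
    then have "(\<Sum>i\<in>I. a (\<rho> (other i))) \<le> (\<Sum>j\<in>{3..<3 + 4}. a j)" using card4 by (intro top) auto
    also have "{3..<3 + 4} = {3, 4, 5, 6::nat}" by auto
    finally have "a 2 \<le> a 6" using sum_I by simp
    then have all: "a 3 = a 2" "a 4 = a 2" "a 5 = a 2"
      using decseqD[OF a(1), of 2 3] decseqD[OF a(1), of 3 6] decseqD[OF a(1), of 2 4]
        decseqD[OF a(1), of 4 6] decseqD[OF a(1), of 2 5] decseqD[OF a(1), of 5 6] by auto
    obtain i where iI: "i \<in> I" using card4 by fastforce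
    have "(\<Sum>j\<in>I - {i}. a (\<rho> (other j))) \<le> (\<Sum>j\<in>I - {i}. a 2)"
      using \<rho>_ge decseqD[OF a(1)] by (intro sum_mono) auto
    also have "\<dots> = 3 * a 2" using card4 iI finI by (simp add: card_Diff_singleton)
    finally have "a 2 \<le> a (\<rho> (other i))"
      using sum_I all iI finI by (simp add: sum.remove)
    then have "a (\<rho> (other i)) = a 2" using decseqD[OF a(1) \<rho>_ge[OF iI]] by simp
    then show ?thesis using that iI a_\<rho>[OF other(1)[OF iI]] by simp
  qed
  \<comment> \<open>With \<open>u = u' = c\<close> the link of \<open>w\<close> is a closed walk \<open>g\<close> that meets \<open>c\<close> exactly at the times \<open>0\<close>, \<open>m\<close>
    and \<open>k\<close>.\<close>
  obtain m where m: "c = v m" "m < k" using cV img_v by auto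
  have "m \<noteq> 0" using m v0 c_w by metis
  have m3: "3 \<le> m" "m \<le> k - 3"
  proof -
    have "v m \<noteq> v 1" "v m \<noteq> v 2" using m start(2) u2 uc by auto
    then have "m \<noteq> 1" "m \<noteq> 2" by metis+
    then show "3 \<le> m" using \<open>m \<noteq> 0\<close> by linarith
    have "v m \<noteq> v (k - 1)" "v m \<noteq> v (k - 2)" using m final(2) u2' uc by auto
    then have "m \<noteq> k - 1" "m \<noteq> k - 2" by metis+
    then show "m \<le> k - 3" using m(2) by linarith
  qed
  define g where "g i = (if i = 0 \<or> i = k then c else v i)" for i
  have lg: "l i = g i" if "i < k" for i using that uc(1) unfolding l_def g_def by simp
  have rg: "r i = g (Suc i)" if "i < k" for i using that uc(2) unfolding r_def g_def by auto
  have g_eq: "g i = g j \<longleftrightarrow> i = j" if "1 \<le> i" "i < k" "i \<noteq> m" "j \<le> k" for i j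
    using that m v_eq[of i j] v_eq[of i m] by (auto simp: g_def)
  have gV: "g i \<in> verts H" if "i \<le> k" for i using that cV img_v by (auto simp: g_def)
  have gw: "g i \<noteq> w" if "i \<le> k" for i using that c_w vw[of i] by (auto simp: g_def)
  have gc: "i = 0 \<or> i = m \<or> i = k" if "g i = c" "i \<le> k" for i
    using that m v_eq[of i m] by (auto simp: g_def split: if_splits)
  have walk: "\<mu> (x (g i)) = x w * (x (g (i - 1)) + x (g (Suc i)))" if i: "1 \<le> i" "i < k" "i \<noteq> m" for i
  proof -
    have only: "g j = g i \<longleftrightarrow> j = i" if "j \<le> k" for j
      using g_eq[OF i that] by (metis (no_types))
    have "{j\<in>{..<k}. l j = g i} = {i}" using lg only i by auto
    moreover have "{j\<in>{..<k}. r j = g i} = {i - 1}"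
    proof -
      have "r j = g i \<longleftrightarrow> j = i - 1" if "j < k" for j
        using rg[OF that] only[of "Suc j"] that i(1) by auto
      then show ?thesis using i by auto
    qed
    ultimately show ?thesis
      using link[OF _ _ gw[of i]] eigen(1)[OF gV[of i]] i lg rg by (simp add: add.commute)
  qed
  \<comment> \<open>Starting from \<open>c\<close> into a neighbour of weight \<open>a 2\<close>, the eigenequations force the weights \<open>a 3\<close> and then
    \<open>a 1\<close> on the next vertices; only \<open>c\<close> is that heavy, so the walk closes a triangle.\<close>
  have back_at_c: "g d = c"
    if "x (g b) = a 2" "\<mu> (x (g b)) = x w * (x c + x (g e))"
      "\<mu> (x (g e)) = x w * (x (g b) + x (g d))" "d \<le> k" for b d e
  proof (rule ccontr)
    assume "g d \<noteq> c"
    have "x c = a 1" by (simp add: a_small c_def)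
    then have "x (g e) = a 3" using that(1,2) \<mu>(2) xw by simp
    then have "x (g d) = a 1" using that(1,3) \<mu>(3) xw by simp
    then show False using x_le[OF gV gw \<open>g d \<noteq> c\<close>] that(4) strict by simp
  qed
  have ends: "g 0 = c" "g k = c" "g m = c" using m by (simp_all add: g_def)
  have "m = 3 \<or> m = k - 3"
  proof -
    consider "other i = g 1" | "other i = g (m + 1)" | "other i = g (m - 1)" | "other i = g (k - 1)"
    proof (cases "l i = c")
      case True
      then have "i = 0 \<or> i = m" using gc[of i] lg i(1) by (auto simp: I_def)
      then show ?thesis using that True rg i(1) by (auto simp: other_def I_def)
    next
      case False
      then have "Suc i = m \<or> Suc i = k" using gc[of "Suc i"] rg i(1) by (auto simp: I_def)
      then show ?thesis using that False lg i(1) by (auto simp: other_def I_def)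
    qed
    then show ?thesis
    proof cases
      case 1
      have "g 3 = c"
        using back_at_c[of 1 2 3] walk[of 1] walk[of 2] i(2) 1 m3 k ends by (simp add: numeral_2_eq_2 numeral_3_eq_3)
      then show ?thesis using gc[of 3] k by auto
    next
      case 2
      have "g (m + 3) = c"
        using back_at_c[of "m + 1" "m + 2" "m + 3"] walk[of "m + 1"] walk[of "m + 2"] i(2) 2 m3 k ends
        by (simp add: numeral_2_eq_2 numeral_3_eq_3)
      moreover have "m + 3 \<le> k" using m3 k by linarith
      ultimately have "m + 3 = 0 \<or> m + 3 = m \<or> m + 3 = k" by (rule gc)
      then show ?thesis using m3 k by linarith
    next
      case 3
      have "Suc (m - 1) = m" "Suc (m - 2) = m - 1" "m - 1 - 1 = m - 2" "m - 2 - 1 = m - 3" using m3 by auto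
      then have "g (m - 3) = c"
        using back_at_c[of "m - 1" "m - 2" "m - 3"] walk[of "m - 1"] walk[of "m - 2"] i(2) 3 m3 k ends
        by (simp add: add.commute)
      moreover have "m - 3 \<le> k" using m3 k by linarith
      ultimately have "m - 3 = 0 \<or> m - 3 = m \<or> m - 3 = k" by (rule gc)
      then show ?thesis using m3 k by linarith
    next
      case 4
      have "Suc (k - 1) = k" "Suc (k - 2) = k - 1" "k - 1 - 1 = k - 2" "k - 2 - 1 = k - 3" using k by auto
      then have "g (k - 3) = c"
        using back_at_c[of "k - 1" "k - 2" "k - 3"] walk[of "k - 1"] walk[of "k - 2"] i(2) 4 m3 k ends
        by (simp add: add.commute)
      moreover have "k - 3 \<le> k" using m3 k by linarith
      ultimately have "k - 3 = 0 \<or> k - 3 = m \<or> k - 3 = k" by (rule gc)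
      then show ?thesis using m3 k by linarith
    qed
  qed
  have V: "verts H = insert w (v ` {1..<k})"
  proof -
    have "{..<k} = insert 0 {1..<k}" using k by auto
    then show ?thesis using img_v v0 by (metis image_insert)
  qed
  have wv: "w \<notin> v ` {1..<k}" using vw by (metis atLeastLessThan_iff imageE)
  have Eg: "edges H = (\<lambda>i. {w, g i, g (Suc i)}) ` {..<k}"
  proof -
    have "edges H = E ` {..<k}" using E by (simp add: bij_betw_def)
    also have "\<dots> = (\<lambda>i. {w, g i, g (Suc i)}) ` {..<k}"
      using E_lr lg rg by (intro image_cong) auto
    finally show ?thesis .
  qed
  from \<open>m = 3 \<or> m = k - 3\<close> show ?thesis
  proof
    assume "m = 3"
    then show ?thesis
      by (intro iso_suspension_Delta2[OF k inj wv V Eg]) (simp add: g_def m)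
  next
    \<comment> \<open>The triangle is at the end of the walk, so the walk is reversed.\<close>
    assume mk: "m = k - 3"
    have rev: "(\<lambda>i. k - i) ` {1..<k} = {1..<k}"
    proof
      show "{1..<k} \<subseteq> (\<lambda>i. k - i) ` {1..<k}"
      proof
        fix i assume "i \<in> {1..<k}"
        then have "i = k - (k - i)" "k - i \<in> {1..<k}" by auto
        then show "i \<in> (\<lambda>i. k - i) ` {1..<k}" by blast
      qed
    qed auto
    show ?thesis
    proof (rule iso_suspension_Delta2[OF k, where q = "\<lambda>i. v (k - i)" and w = w and g = "\<lambda>i. g (k - i)"])
      have img: "(\<lambda>i. v (k - i)) ` {1..<k} = v ` {1..<k}" using rev by (metis image_image)
      show "inj_on (\<lambda>i. v (k - i)) {1..<k}"
        by (intro inj_onI) (auto simp: v_eq)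
      show "w \<notin> (\<lambda>i. v (k - i)) ` {1..<k}" unfolding img by (rule wv)
      show "verts H = insert w ((\<lambda>i. v (k - i)) ` {1..<k})" unfolding img by (rule V)
      have "{..<k} = (\<lambda>i. k - Suc i) ` {..<k}"
      proof
        show "{..<k} \<subseteq> (\<lambda>i. k - Suc i) ` {..<k}"
        proof
          fix i assume "i \<in> {..<k}"
          then have "i = k - Suc (k - Suc i)" "k - Suc i \<in> {..<k}" by auto
          then show "i \<in> (\<lambda>i. k - Suc i) ` {..<k}" by blast
        qed
      qed auto
      then have "edges H = (\<lambda>i. {w, g i, g (Suc i)}) ` (\<lambda>i. k - Suc i) ` {..<k}" using Eg by simp
      also have "\<dots> = (\<lambda>i. {w, g (k - i), g (k - Suc i)}) ` {..<k}"
        unfolding image_image by (intro image_cong) (auto simp: Suc_diff_Suc)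
      finally show "edges H = \<dots>" .
      show "g (k - i) = (if i = 0 \<or> i = k then v (k - 3) else v (k - i))" if "i \<le> k" for i
        using m mk k that by (auto simp: g_def)
    qed
  qed
qed


text \<open>
  Consecutive edges of the cycle share a vertex, so a set separated from its complement by all edges
  contains either all edges or none, and edges cover the vertices.
\<close>

lemma Berge_cycle_connected:
  assumes k: "3 \<le> k" and H: "uniform_hypergraph r H" and iso: "no_isolated_vertices H"
    and B: "is_Berge (cycle_graph k) H"
    and Z: "Z \<subseteq> verts H" "Z \<noteq> {}" "Z \<noteq> verts H"
  shows "\<exists>e\<in>edges H. e \<inter> Z \<noteq> {} \<and> \<not> e \<subseteq> Z"
proof (rule ccontr)
  assume "\<not> ?thesis"
  then have sep: "\<And>e. e \<in> edges H \<Longrightarrow> e \<inter> Z = {} \<or> e \<subseteq> Z" by blast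
  from Berge_cycle_edges[OF k B] obtain v E where
    E: "bij_betw E {..<k} (edges H)" and vE: "\<And>i. i < k \<Longrightarrow> {v i, v (Suc i mod k)} \<subseteq> E i" by metis
  have EH: "E i \<in> edges H" if "i < k" for i using E that by (auto simp: bij_betw_def)
  have step: "(v i \<in> Z \<longleftrightarrow> E i \<subseteq> Z) \<and> (v (Suc i mod k) \<in> Z \<longleftrightarrow> E i \<subseteq> Z)" if "i < k" for i
    using sep[OF EH[OF that]] vE[OF that] by blast
  have "i < k \<longrightarrow> (v i \<in> Z \<longleftrightarrow> v 0 \<in> Z)" for i
  proof (induction i)
    case (Suc i)
    then show ?case using step[of i] by auto
  qed simp
  then have same: "E i \<subseteq> Z \<longleftrightarrow> v 0 \<in> Z" if "i < k" for i using step[OF that] that by blast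
  have edge: "\<exists>i<k. y \<in> E i" if y: "y \<in> verts H" for y
  proof -
    obtain e where "e \<in> edges H" "y \<in> e" using iso y by (auto simp: no_isolated_vertices_def)
    then show ?thesis using E by (auto simp: bij_betw_def)
  qed
  show False
  proof (cases "v 0 \<in> Z")
    case True
    then have "verts H \<subseteq> Z" using same edge by blast
    then show False using Z by blast
  next
    case False
    obtain z where "z \<in> Z" using Z by blast
    then obtain i where "i < k" "z \<in> E i" using edge Z(1) by blast
    then show False using same[of i] sep[OF EH[of i]] False \<open>z \<in> Z\<close> by blast
  qed
qed

theorem theorem1p2:
  fixes p :: real and k :: nat and H :: "'a hypergraph"
  assumes "p \<ge> 1"
    and "k \<ge> 6"
    and "uniform_hypergraph 3 H"
    and "no_isolated_vertices H"
    and "is_Berge (cycle_graph k) H"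
  shows "p_spectral_radius 3 p H \<le> p_spectral_radius 3 p (suspension (Delta2 k)) \<and>
         (p > 2 \<longrightarrow>
           (p_spectral_radius 3 p H = p_spectral_radius 3 p (suspension (Delta2 k)) \<longleftrightarrow>
            H \<simeq>\<^sub>H suspension (Delta2 k)))"
proof -
  note p = assms(1) and k = assms(2) and H = assms(3) and no_iso = assms(4) and B = assms(5)
  let ?V = "verts H"
  have finV: "finite ?V" by (rule uniform_finite(1)[OF H])
  have k3: "3 \<le> k" using k by simp
  from Berge_cycle_edges[OF k3 B, of undefined] obtain v E where
    v: "v ` {..<k} \<subseteq> ?V" and E: "bij_betw E {..<k} (edges H)" by this
  have k0: "0 \<in> {..<k}" using k by simp
  have ne: "?V \<noteq> {}" using v imageI[OF k0, of v] by blast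
  obtain x where x: "\<And>i. 0 \<le> x i" "p_norm_on ?V p x = 1"
    "p_spectral_radius 3 p H = real 3 * edge_sum H x"
    using nonneg_maximiser[OF H ne p] by blast
  obtain h where h: "bij_betw h {..<card ?V} ?V"
    and sorted: "\<And>i j. i \<le> j \<Longrightarrow> j < card ?V \<Longrightarrow> x (h j) \<le> x (h i)"
    using decreasing_enumeration[OF finV, of x] by blast
  note core = edge_sum_le_core_edge_sum[where x = x and h = h, OF k H B x(1) h sorted]
  define D where "D = core_hypergraph k h"
  let ?L = "p_spectral_radius 3 p D"
  have inj_h: "inj_on h {..<k}"
    using h core(1) by (auto simp: bij_betw_def intro: inj_on_subset)
  have D: "uniform_hypergraph 3 D" unfolding D_def by (rule core_hypergraph_uniform[OF k inj_h])
  have VD: "verts D = h ` {..<k}" by (simp add: D_def core_hypergraph_def)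
  have VD_sub: "verts D \<subseteq> ?V" using h core(1) by (auto simp: VD bij_betw_def)
  have neD: "verts D \<noteq> {}" using k0 by (auto simp: VD)
  have L: "?L = p_spectral_radius 3 p (suspension (Delta2 k))"
    by (rule spectral_radius_iso_invariant[OF D]) (unfold D_def, rule core_hypergraph_iso[OF k inj_h])
  have L0: "0 \<le> ?L"
  proof -
    obtain y where "\<And>i. 0 \<le> y i" "?L = real 3 * edge_sum D y" using nonneg_maximiser[OF D neD p] by blast
    then show ?thesis by (simp add: edge_sum_def sum_nonneg prod_nonneg)
  qed
  let ?N = "p_norm_on (verts D) p x"
  have N: "0 \<le> ?N" "?N \<le> 1"
    using p_norm_on_mono[OF finV VD_sub p, of x] x(2) by (auto simp: p_norm_on_def)
  have chain: "p_spectral_radius 3 p H \<le> real 3 * edge_sum D x" "real 3 * edge_sum D x \<le> ?L * ?N ^ 3"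
    using core(2) x(3) edge_sum_le_radius_norm[OF D neD p, of x] by (simp_all add: D_def)
  have "?L * ?N ^ 3 \<le> ?L" using L0 N by (simp add: mult_left_le power_le_one)
  with chain have le: "p_spectral_radius 3 p H \<le> ?L" by linarith
  have "H \<simeq>\<^sub>H suspension (Delta2 k)" if p2: "2 < p" and eq: "p_spectral_radius 3 p H = ?L"
  proof -
    have pos: "0 < x z" if "z \<in> ?V" for z
      using maximiser_positive[where x = x, OF H p _ _ x Berge_cycle_connected[OF k3 H no_iso B] that] p2 by simp
    have "0 < edge_sum H x"
    proof -
      have "edges H \<noteq> {}" using E k0 by (auto simp: bij_betw_def)
      then show ?thesis
        unfolding edge_sum_def using uniform_finite(2,4)[OF H] pos
        by (intro sum_pos prod_pos) blast+
    qed
    then have Lpos: "0 < ?L" using eq x(3) by simp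
    have "?L \<le> ?L * ?N ^ 3" using chain eq by linarith
    then have "1 \<le> ?N ^ 3" using Lpos by simp
    also have "?N ^ 3 \<le> ?N ^ 1" using N by (intro power_decreasing) auto
    finally have N1: "?N = 1" using N(2) by simp
    have "3 * edge_sum H x = 3 * edge_sum D x" using chain eq x(3) N1 by simp
    then have sums: "edge_sum H x = edge_sum D x" by simp
    have max_D: "?L = real 3 * edge_sum D x" using sums eq x(3) by simp
    have norm_sum: "(\<Sum>i\<in>T. \<bar>x i\<bar> powr p) = 1" if "p_norm_on T p x = 1" for T
    proof -
      have "((\<Sum>i\<in>T. \<bar>x i\<bar> powr p) powr (1 / p)) powr p = 1"
        using that by (simp add: p_norm_on_def)
      then show ?thesis using p by (simp add: powr_powr sum_nonneg)
    qed
    \<comment> \<open>The copy alone has norm 1, so no positive weight is left for further vertices.\<close>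
    have "?V - verts D = {}"
    proof (rule ccontr)
      assume "?V - verts D \<noteq> {}"
      then have "0 < (\<Sum>i\<in>?V - verts D. \<bar>x i\<bar> powr p)"
        using finV pos by (intro sum_pos) force+
      moreover have "(\<Sum>i\<in>?V. \<bar>x i\<bar> powr p) = (\<Sum>i\<in>?V - verts D. \<bar>x i\<bar> powr p) + (\<Sum>i\<in>verts D. \<bar>x i\<bar> powr p)"
        by (rule sum.subset_diff[OF VD_sub finV])
      ultimately show False using norm_sum[OF x(2)] norm_sum[OF N1] by simp
    qed
    then have V_eq: "verts D = ?V" using VD_sub by blast
    then have card_V: "card ?V = k" using card_image[OF inj_h] VD by simp
    show ?thesis
    proof (rule extremal_Berge_cycle_iso[where x = x and h = h and \<mu> = "\<lambda>t. ?L * t powr (p - 1)",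
            OF k H B h[unfolded card_V] sorted[unfolded card_V] pos])
      show "edge_sum H x = edge_sum (core_hypergraph k h) x" using sums by (simp add: D_def)
      show "link_sum H x z = ?L * x z powr (p - 1)" if "z \<in> ?V" for z
        using eigen_equation[OF H p _ x(2,3) that pos[OF that]] eq by simp
      show "link_sum (core_hypergraph k h) x z = ?L * x z powr (p - 1)" if z: "z \<in> ?V" for z
      proof -
        have "z \<in> verts D" using z V_eq by simp
        from eigen_equation[OF D p _ N1 max_D this pos[OF z]] show ?thesis by (simp add: D_def)
      qed
    qed
  qed
  then show ?thesis
    using le spectral_radius_iso_invariant[OF H, of "suspension (Delta2 k)" 3 p] by (auto simp: L)
qed

end
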